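(* Let $d\ge 2$ and let $\Lambda\subset\mathbb{R}^d$ be a self-affine sponge. Then $$\dim_{\mathrm H}\Lambda\ \ge\ \sup_{\mathbf p}\left\{\sum_{k=1}^{d-1}\lambda_k(\mathbf p)+t(\mathbf p)\right\},$$ where the supremum is over all distributions $\mathbf p=(p_{i^1\ldots i^{d-1}})$ on $\mathcal J$.
   Context: $\dim_{\mathrm H}$ denotes Hausdorff dimension. **Self-affine sponges.** Let $d\ge2$ be an integer. Let $$\mathcal I=\{(i^1,\ldots,i^d): 1\le i^1\le m,\ 1\le i^2\le m_{i^1},\ 1\le i^3\le m_{i^1i^2},\ \ldots,\ 1\le i^d\le m_{i^1\ldots i^{d-1}}\}$$ be a finite index set (with $m$ and all $m_{i^1\ldots i^k}$ positive integers). For each $k=1,\ldots,d$ and each admissible $(i^1,\ldots,i^k)$ (initial segment of an element of $\mathcal I$) let $0<a_{i^1\ldots i^k}<1$ and $0\le u_{i^1\ldots i^k}<1$ be numbers such that: (1) $a_{i^1\ldots i^ki^{k+1}}\le a_{i^1\ldots i^k}$ for $k<d$; (2) $\sum_{i^k=1}^{m_{i^1\ldots i^{k-1}}}a_{i^1\ldots i^k}\le1$ for each $k$ and each admissible $(i^1,\ldots,i^{k-1})$ (for $k=1$ the upper limit is $m$); (3) for each $k$ and each admissible $(i^1,\ldots,i^{k})$ with $i^k$ not the last value of its range, $u_{i^1\ldots i^{k-1}i^k}<u_{i^1\ldots i^{k-1}(i^k+1)}$ and $u_{i^1\ldots i^{k-1}(i^k+1)}-u_{i^1\ldots i^{k-1}i^k}\ge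 a_{i^1\ldots i^k}$; and if $i^k$ is the last value of its range, $1-u_{i^1\ldots i^k}\ge a_{i^1\ldots i^k}$. For $(i^1,\ldots,i^d)\in\mathcal I$ define $A_{i^1\ldots i^d}:\mathbb R^d\to\mathbb R^d$ by $$A_{i^1\ldots i^d}(x_1,\ldots,x_d)=\big(a_{i^1\ldots i^d}x_1+u_{i^1\ldots i^d},\ a_{i^1\ldots i^{d-1}}x_2+u_{i^1\ldots i^{d-1}},\ \ldots,\ a_{i^1}x_d+u_{i^1}\big).$$ The unique nonempty compact set $\Lambda\subset\mathbb R^d$ with $\Lambda=\bigcup_{(i^1,\ldots,i^d)\in\mathcal I}A_{i^1\ldots i^d}(\Lambda)$ is called a self-affine sponge. **Distributions.** Let $\mathcal J=\{(i^1,\ldots,i^{d-1}):(i^1,\ldots,i^d)\in\mathcal I\text{ for some }i^d\}$. A distribution $\mathbf p$ on $\mathcal J$ is a collection $\mathbf p=(p_{i^1\ldots i^{d-1}})_{\mathcal J}$ of non-negative numbers with total sum $1$; put $p_{i^1\ldots i^k}=\sum_{i^{k+1}}p_{i^1\ldots i^ki^{k+1}}$ for $k=d-2,\ldots,1$, so that $\sum_{i^1}p_{i^1}=1$. Define, for $k=1,\ldots,d-1$, $$\lambda_k(\mathbf p)=\frac{\sum_{i^1\ldots i^k}p_{i^1\ldots i^k}\log p_{i^1\ldots i^k}-\sum_{i^1\ldots i^{k-1}}p_{i^1\ldots i^{k-1}}\log p_{i^1\ldots i^{k-1}}}{\sum_{i^1\ldots i^k}p_{i^1\ldots i^k}\log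 a_{i^1\ldots i^k}}$$ (with $0\log0=0$, and for $k=1$ the second sum in the numerator is $0$). Let $t(\mathbf p)$ be the unique real number in $[0,1]$ satisfying $$\sum_{i^1\ldots i^{d-1}}p_{i^1\ldots i^{d-1}}\log\Big(\sum_{i^d}a_{i^1\ldots i^{d-1}i^d}^{t(\mathbf p)}\Big)=0.$$ *)

theory Defs
  imports "HOL-Analysis.Analysis"
begin

section \<open>Hausdorff measure and dimension\<close>

text \<open>
  The \<open>s\<close>-th power of the diameter of a covering set, with the usual conventions that the
  empty set contributes \<open>0\<close> and that, for \<open>s = 0\<close>, every nonempty set contributes \<open>1\<close>
  (note that \<open>0 powr 0 = 0\<close> in HOL).
\<close>

definition diam_power :: "real \<Rightarrow> 'a::metric_space set \<Rightarrow> ennreal" where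
  "diam_power s U =
     (if U = {} then 0 else if s = 0 then 1 else ennreal (diameter U powr s))"

text \<open>
  The sets of a cover are required to be bounded because \<open>diameter\<close> is unspecified on
  unbounded sets.
\<close>

definition hausdorff_premeasure :: "real \<Rightarrow> real \<Rightarrow> 'a::metric_space set \<Rightarrow> ennreal" where
  "hausdorff_premeasure \<delta> s S =
     Inf {(\<Sum>i. diam_power s (U i)) | U :: nat \<Rightarrow> 'a set.
            S \<subseteq> (\<Union>i. U i) \<and> (\<forall>i. bounded (U i) \<and> diameter (U i) \<le> \<delta>)}"

definition hausdorff_measure :: "real \<Rightarrow> 'a::metric_space set \<Rightarrow> ennreal" where
  "hausdorff_measure s S = (SUP \<delta>\<in>{0<..}. hausdorff_premeasure \<delta> s S)"

definition hausdorff_dim :: "'a::metric_space set \<Rightarrow> ereal" where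
  "hausdorff_dim S = Inf {ereal s | s. 0 \<le> s \<and> hausdorff_measure s S = 0}"


section \<open>Self-affine sponges\<close>

text \<open>
  The tuple \<open>(i\<^sup>1, \<dots>, i\<^sup>k)\<close> is the list \<open>[i\<^sup>1, \<dots>, i\<^sup>k]\<close>, and \<open>m w\<close> is the number of admissible
  one-letter extensions of \<open>w\<close>; thus \<open>m []\<close> is the bound for the first index.  The index set
  \<open>\<I>\<close> is \<open>words m d\<close>, and \<open>\<J>\<close> is \<open>words m (d - 1)\<close> (every \<open>m w\<close> is positive).
\<close>

definition words :: "(nat list \<Rightarrow> nat) \<Rightarrow> nat \<Rightarrow> nat list set" where
  "words m k = {w. length w = k \<and> (\<forall>j<k. w ! j \<in> {1..m (take j w)})}"

locale sponge_data =
  fixes d :: nat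
    and m :: "nat list \<Rightarrow> nat"
    and a u :: "nat list \<Rightarrow> real"
  assumes d_ge_2: "2 \<le> d"
    and m_pos: "\<And>k w. k < d \<Longrightarrow> w \<in> words m k \<Longrightarrow> 1 \<le> m w"
    and a_range: "\<And>k w. k \<in> {1..d} \<Longrightarrow> w \<in> words m k \<Longrightarrow> 0 < a w \<and> a w < 1"
    and u_range: "\<And>k w. k \<in> {1..d} \<Longrightarrow> w \<in> words m k \<Longrightarrow> 0 \<le> u w \<and> u w < 1"
    and a_decreasing:
      "\<And>k w i. k \<in> {1..<d} \<Longrightarrow> w \<in> words m k \<Longrightarrow> i \<in> {1..m w} \<Longrightarrow> a (w @ [i]) \<le> a w"
    and a_sum_le_1:
      "\<And>k w. k < d \<Longrightarrow> w \<in> words m k \<Longrightarrow> (\<Sum>i=1..m w. a (w @ [i])) \<le> 1"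
    and u_increasing:
      "\<And>k w i. k < d \<Longrightarrow> w \<in> words m k \<Longrightarrow> i \<in> {1..<m w} \<Longrightarrow>
         u (w @ [i]) < u (w @ [i + 1])"
    and u_gap:
      "\<And>k w i. k < d \<Longrightarrow> w \<in> words m k \<Longrightarrow> i \<in> {1..<m w} \<Longrightarrow>
         a (w @ [i]) \<le> u (w @ [i + 1]) - u (w @ [i])"
    and u_last:
      "\<And>k w. k < d \<Longrightarrow> w \<in> words m k \<Longrightarrow> a (w @ [m w]) \<le> 1 - u (w @ [m w])"

text \<open>
  \<open>\<real>\<^sup>d\<close> is \<open>real ^ 'n\<close>, whose coordinates are numbered by a bijection \<open>pos\<close> from \<open>'n\<close> onto
  \<open>{1..d}\<close>: the coordinate \<open>x\<^sub>j\<close> is \<open>x $ c\<close> with \<open>pos c = j\<close>.  It is scaled and translated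
  according to the initial segment of length \<open>d + 1 - j\<close>.
\<close>

definition sponge_map ::
  "nat \<Rightarrow> (nat list \<Rightarrow> real) \<Rightarrow> (nat list \<Rightarrow> real) \<Rightarrow> ('n::finite \<Rightarrow> nat) \<Rightarrow>
     nat list \<Rightarrow> real ^ 'n \<Rightarrow> real ^ 'n" where
  "sponge_map d a u pos w x =
     (\<chi> c. a (take (d + 1 - pos c) w) * x $ c + u (take (d + 1 - pos c) w))"

definition is_sponge ::
  "nat \<Rightarrow> (nat list \<Rightarrow> nat) \<Rightarrow> (nat list \<Rightarrow> real) \<Rightarrow> (nat list \<Rightarrow> real) \<Rightarrow>
     ('n::finite \<Rightarrow> nat) \<Rightarrow> (real ^ 'n) set \<Rightarrow> bool" where
  "is_sponge d m a u pos \<Lambda> \<longleftrightarrow>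
     compact \<Lambda> \<and> \<Lambda> \<noteq> {} \<and> \<Lambda> = (\<Union>w\<in>words m d. sponge_map d a u pos w ` \<Lambda>)"


section \<open>Distributions\<close>

definition distributions :: "nat \<Rightarrow> (nat list \<Rightarrow> nat) \<Rightarrow> (nat list \<Rightarrow> real) set" where
  "distributions d m =
     {p. (\<forall>w\<in>words m (d - 1). 0 \<le> p w) \<and> (\<Sum>w\<in>words m (d - 1). p w) = 1}"

fun sum_extensions ::
  "(nat list \<Rightarrow> nat) \<Rightarrow> (nat list \<Rightarrow> real) \<Rightarrow> nat \<Rightarrow> nat list \<Rightarrow> real" where
  "sum_extensions m p 0 w = p w"
| "sum_extensions m p (Suc n) w = (\<Sum>i=1..m w. sum_extensions m p n (w @ [i]))"

definition marginal ::
  "nat \<Rightarrow> (nat list \<Rightarrow> nat) \<Rightarrow> (nat list \<Rightarrow> real) \<Rightarrow> nat list \<Rightarrow> real" where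
  "marginal d m p w = sum_extensions m p (d - 1 - length w) w"

text \<open>
  The convention \<open>0 log 0 = 0\<close> is automatic.  For \<open>k = 1\<close> the second sum of the numerator
  consists of the single term for \<open>[]\<close>, which is \<open>1 * ln 1 = 0\<close> for a distribution.
\<close>

definition sponge_lambda ::
  "nat \<Rightarrow> (nat list \<Rightarrow> nat) \<Rightarrow> (nat list \<Rightarrow> real) \<Rightarrow> (nat list \<Rightarrow> real) \<Rightarrow> nat \<Rightarrow> real" where
  "sponge_lambda d m a p k =
     ((\<Sum>w\<in>words m k. marginal d m p w * ln (marginal d m p w))
        - (\<Sum>w\<in>words m (k - 1). marginal d m p w * ln (marginal d m p w)))
     / (\<Sum>w\<in>words m k. marginal d m p w * ln (a w))"

definition sponge_t ::
  "nat \<Rightarrow> (nat list \<Rightarrow> nat) \<Rightarrow> (nat list \<Rightarrow> real) \<Rightarrow> (nat list \<Rightarrow> real) \<Rightarrow> real" where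
  "sponge_t d m a p =
     (THE t. 0 \<le> t \<and> t \<le> 1 \<and>
        (\<Sum>w\<in>words m (d - 1). p w * ln (\<Sum>i=1..m w. a (w @ [i]) powr t)) = 0)"

end

theory Submission
  imports Defs "HOL-Probability.Probability"
begin

text \<open>
  Points of the sponge are coded by sequences of letters \<open>(i\<^sup>1, \<dots>, i\<^sup>d)\<close>.  A distribution \<open>p\<close> on the
  words of length \<open>d - 1\<close> gives a probability \<open>P\<close> on letters, in which the last index is chosen with
  probability proportional to \<open>a powr t(p)\<close>, and hence a Bernoulli measure on sequences.  The
  dimension of this measure is \<open>\<lambda>\<^sub>1(p) + \<dots> + \<lambda>\<^sub>d\<^sub>-\<^sub>1(p) + t(p)\<close>, and it bounds the dimension of the
  sponge from below.

  The natural neighbourhoods of a coded point are approximate cubes: sets of sequences for which the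
  prefix of length \<open>k\<close> is fixed at as many places as are needed to make the side at level \<open>k\<close>
  comparable to \<open>r\<close>.  The measure of an approximate cube is a product over the levels, in which level
  \<open>k\<close> contributes the conditional probabilities of the index \<open>i\<^sup>k\<close> given the earlier ones.  By the law of
  large numbers this contribution is about \<open>r\<close> to the power (conditional entropy) / (Lyapunov
  exponent), which is \<open>\<lambda>\<^sub>k(p)\<close> for \<open>k < d\<close> and \<open>t(p)\<close> for \<open>k = d\<close>
  (\<open>emeasure_cube\<close>, \<open>prod_ratio_le_powr\<close>, \<open>distribution_lower_bound\<close>).

  Approximate cubes replace balls because the conditions on \<open>u\<close> separate sibling intervals: distinct
  cubes of size \<open>r\<close> have distinct positions in a grid of mesh comparable to \<open>r\<close>
  (\<open>cube_eqI_grid_index\<close>), so boundedly many of them meet a set of diameter at most \<open>r\<close>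
  (\<open>card_cubes_le\<close>).  The mass distribution principle then shows that the Hausdorff measures of
  exponent less than the dimension of the Bernoulli measure do not vanish (\<open>bernoulli_lower_bound\<close>).
\<close>

section \<open>A one-sided law of large numbers\<close>

lemma indep_vars_PiM_coordinates:
  assumes "\<And>i. prob_space (N i)"
  shows "prob_space.indep_vars (Pi\<^sub>M UNIV N) N (\<lambda>i \<omega>. \<omega> i) UNIV"
proof -
  interpret product_prob_space N UNIV
    using assms by (rule product_prob_spaceI)
  show ?thesis
  proof (subst P.indep_vars_iff_distr_eq_PiM')
    show "distr (Pi\<^sub>M UNIV N) (Pi\<^sub>M UNIV N) (\<lambda>x. \<lambda>i\<in>UNIV. x i) =
          Pi\<^sub>M UNIV (\<lambda>i. distr (Pi\<^sub>M UNIV N) (N i) (\<lambda>\<omega>. \<omega> i))"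
      by (simp add: PiM_component restrict_def distr_id2)
  qed auto
qed

text \<open>
  Hoeffding's inequality makes the probability that the \<open>n\<close>-th partial sum lies below \<open>- \<epsilon> n\<close>
  decay exponentially in \<open>n\<close>, so by Borel--Cantelli this happens for only finitely many \<open>n\<close>; the
  constant \<open>K\<close> absorbs those.  With a constant in place of a bound for all large \<open>n\<close>, the set of
  sequences with a given \<open>K\<close> obeys an estimate that is uniform over the set, and some such set has
  positive measure.
\<close>

lemma iid_sum_ge_linear_AE:
  fixes P :: "'b pmf" and f :: "'b \<Rightarrow> real"
  assumes fin: "finite (set_pmf P)"
    and mean: "measure_pmf.expectation P f = 0"
    and \<epsilon>: "\<epsilon> > 0"
  shows "AE \<omega> in Pi\<^sub>M UNIV (\<lambda>_::nat. measure_pmf P).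
           \<exists>K::nat. \<forall>n. (\<Sum>j<n. f (\<omega> j)) \<ge> - \<epsilon> * real n - real K"
proof -
  define M where "M = Pi\<^sub>M UNIV (\<lambda>_::nat. measure_pmf P)"
  interpret product_prob_space "\<lambda>_::nat. measure_pmf P" UNIV
    by unfold_locales
  have [measurable]: "(\<lambda>\<omega>. f (\<omega> i)) \<in> borel_measurable M" for i
    unfolding M_def by (rule measurable_compose[OF measurable_component_singleton]) auto
  obtain B where B: "B > 0" "\<And>x. x \<in> set_pmf P \<Longrightarrow> \<bar>f x\<bar> \<le> B"
  proof
    show "1 + (\<Sum>x\<in>set_pmf P. \<bar>f x\<bar>) > 0"
      by (meson abs_ge_zero add_pos_nonneg sum_nonneg zero_less_one)
    show "\<bar>f x\<bar> \<le> 1 + (\<Sum>x\<in>set_pmf P. \<bar>f x\<bar>)" if "x \<in> set_pmf P" for x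
      using member_le_sum[OF that, of "\<lambda>x. \<bar>f x\<bar>"] fin by simp
  qed
  have AE_f: "AE \<omega> in M. f (\<omega> i) \<in> {-B..B}" for i
    unfolding M_def
    by (rule AE_component[of i "\<lambda>x. f x \<in> {-B..B}"])
       (use B in \<open>auto simp: AE_measure_pmf_iff abs_le_iff minus_le_iff\<close>)
  have E0: "P.expectation (\<lambda>\<omega>. f (\<omega> i)) = 0" for i
  proof -
    have "P.expectation (\<lambda>\<omega>. f (\<omega> i)) = lebesgue_integral (distr (Pi\<^sub>M UNIV (\<lambda>_::nat. measure_pmf P)) (measure_pmf P) (\<lambda>\<omega>. \<omega> i)) f"
      by (subst integral_distr) auto
    also have "distr (Pi\<^sub>M UNIV (\<lambda>_::nat. measure_pmf P)) (measure_pmf P) (\<lambda>\<omega>. \<omega> i) = measure_pmf P"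
      by (rule PiM_component) simp
    finally show ?thesis using mean by simp
  qed
  have ind: "P.indep_vars (\<lambda>_. borel) (\<lambda>i \<omega>. f (\<omega> i)) UNIV"
    by (rule P.indep_vars_compose2[OF indep_vars_PiM_coordinates]) (simp_all add: prob_space_measure_pmf)
  define A where "A n = {\<omega>\<in>space M. (\<Sum>j<n. f (\<omega> j)) \<le> - (\<epsilon> * real n)}" for n
  have A_meas: "A n \<in> sets M" for n
    unfolding A_def by measurable
  define c where "c = exp (- \<epsilon>\<^sup>2 / (2 * B\<^sup>2))"
  have prob_A: "measure M (A n) \<le> c ^ n" if "n > 0" for n
  proof -
    interpret H: Hoeffding_ineq "Pi\<^sub>M UNIV (\<lambda>_::nat. measure_pmf P)" "{..<n}" "\<lambda>i \<omega>. f (\<omega> i)" "\<lambda>_. -B" "\<lambda>_. B"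
      "\<Sum>i<n. P.expectation (\<lambda>\<omega>. f (\<omega> i))"
    proof unfold_locales
      show "P.indep_vars (\<lambda>_. borel) (\<lambda>i \<omega>. f (\<omega> i)) {..<n}"
        by (rule P.indep_vars_subset[OF ind]) simp
      show "AE \<omega> in Pi\<^sub>M UNIV (\<lambda>_::nat. measure_pmf P). f (\<omega> i) \<in> {-B..B}" for i
        using AE_f unfolding M_def .
    qed simp_all
    have "measure M (A n) \<le> exp (-2 * (\<epsilon> * n)\<^sup>2 / (n * (2*B)\<^sup>2))"
      using H.Hoeffding_ineq_le[of "\<epsilon> * n"] \<epsilon> B \<open>n > 0\<close> by (simp add: E0 A_def M_def)
    also have "-2 * (\<epsilon> * n)\<^sup>2 / (n * (2*B)\<^sup>2) = n * (- \<epsilon>\<^sup>2 / (2 * B\<^sup>2))"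
      using \<open>n > 0\<close> B by (simp add: power2_eq_square field_simps)
    also have "exp \<dots> = c ^ n" unfolding c_def by (rule exp_of_nat_mult)
    finally show ?thesis .
  qed
  have "summable (\<lambda>n. measure M (A n))"
  proof (rule summable_comparison_test')
    show "summable (\<lambda>n. c ^ n)"
      by (rule summable_geometric) (use \<epsilon> B in \<open>simp add: c_def\<close>)
    show "norm (measure M (A n)) \<le> c ^ n" if "n \<ge> 1" for n
      using prob_A that by simp
  qed
  then have "AE \<omega> in M. eventually (\<lambda>n. \<omega> \<in> space M - A n) sequentially"
    using A_meas by (intro borel_cantelli_AE1) (auto simp: M_def less_top[symmetric])
  then show ?thesis
    unfolding M_def[symmetric]
  proof eventually_elim
    case (elim \<omega>)
    then obtain n0 where n0: "\<And>n. n \<ge> n0 \<Longrightarrow> \<omega> \<in> space M - A n"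
      by (auto simp: eventually_sequentially)
    define K where "K = nat \<lceil>\<Sum>j<n0. \<bar>f (\<omega> j)\<bar>\<rceil>"
    have "(\<Sum>j<n. f (\<omega> j)) \<ge> - \<epsilon> * real n - real K" for n
    proof (cases "n \<ge> n0")
      case True
      have "(\<Sum>j<n. f (\<omega> j)) \<ge> - (\<epsilon> * n)" using n0[OF True] by (auto simp: A_def)
      then show ?thesis by simp
    next
      case False
      have "- (\<Sum>j<n. f (\<omega> j)) \<le> (\<Sum>j<n. \<bar>f (\<omega> j)\<bar>)"
        by (subst sum_negf[symmetric]) (intro sum_mono, simp)
      also have "\<dots> \<le> (\<Sum>j<n0. \<bar>f (\<omega> j)\<bar>)"
        using False by (intro sum_mono2) auto
      also have "\<dots> \<le> real K" unfolding K_def by linarith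
      also have "\<dots> \<le> \<epsilon> * real n + real K" using \<epsilon> by simp
      finally show ?thesis by simp
    qed
    then show ?case by blast
  qed
qed

section \<open>Positivity of Hausdorff measures\<close>

text \<open>
  The mass distribution principle for the image of a measure under a coding map \<open>x\<close>: every cover of
  \<open>S\<close> induces a cover of \<open>E\<close>, whose total mass is at most a constant times \<open>\<Sum> diam\<^sup>s\<close>.
  Asking only for a measurable set \<open>T\<close> that contains the part of \<open>E\<close> over \<open>U\<close> avoids
  any question of measurability of \<open>x\<close>.
\<close>

lemma mass_distribution_principle:
  fixes x :: "'b \<Rightarrow> 'a::metric_space"
  assumes s: "s > 0"
    and pos: "emeasure M E > 0"
    and in_S: "\<And>\<omega>. \<omega> \<in> E \<Longrightarrow> x \<omega> \<in> S"
    and C: "C \<ge> 0"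
    and frostman: "\<And>U r. bounded U \<Longrightarrow> diameter U \<le> r \<Longrightarrow> 0 < r \<Longrightarrow> r \<le> 1 \<Longrightarrow>
       \<exists>T\<in>sets M. {\<omega>\<in>E. x \<omega> \<in> U} \<subseteq> T \<and> emeasure M T \<le> ennreal (C * r powr s)"
  shows "hausdorff_measure s S \<noteq> 0"
proof
  assume "hausdorff_measure s S = 0"
  moreover have "hausdorff_premeasure 1 s S \<le> hausdorff_measure s S"
    unfolding hausdorff_measure_def by (rule SUP_upper) simp
  ultimately have zero: "hausdorff_premeasure 1 s S = 0" by simp
  have dp: "diam_power s U = ennreal (diameter U powr s)" for U :: "'a set"
    using s by (auto simp: diam_power_def)
  have E: "emeasure M E \<le> ennreal (2 * C * \<eta>)" if \<eta>: "0 < \<eta>" "\<eta> \<le> 1" for \<eta>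
  proof -
    have "hausdorff_premeasure 1 s S < ennreal \<eta>" using zero \<eta> by simp
    then obtain U :: "nat \<Rightarrow> 'a set" where U: "(\<Sum>i. diam_power s (U i)) < ennreal \<eta>"
      "S \<subseteq> (\<Union>i. U i)" "\<And>i. bounded (U i)" "\<And>i. diameter (U i) \<le> 1"
      unfolding hausdorff_premeasure_def Inf_less_iff by auto
    \<comment> \<open>A covering set may have diameter \<open>0\<close>, but the hypothesis needs a positive scale; enlarging
    the scale of the \<open>i\<close>-th set to \<open>e i\<close> costs only \<open>\<eta> / 2 ^ (i + 1)\<close>.\<close>
    define e where "e i = (\<eta> * (1/2) ^ Suc i) powr (1 / s)" for i
    have e: "e i > 0" "e i \<le> 1" "e i powr s = \<eta> * (1/2) ^ Suc i" for i
    proof -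
      have "\<eta> * (1/2) ^ Suc i \<le> 1 * 1"
        using \<eta> by (intro mult_mono power_le_one) auto
      then show "e i > 0" "e i \<le> 1" "e i powr s = \<eta> * (1/2) ^ Suc i"
        using \<eta> s by (auto simp: e_def powr_powr intro!: powr_le1)
    qed
    define r where "r i = max (diameter (U i)) (e i)" for i
    have r: "diameter (U i) \<le> r i" "0 < r i" "r i \<le> 1" for i
      using e[of i] U(4)[of i] by (auto simp: r_def)
    have "\<forall>i. \<exists>T. T \<in> sets M \<and> {\<omega>\<in>E. x \<omega> \<in> U i} \<subseteq> T \<and> emeasure M T \<le> ennreal (C * r i powr s)"
      using frostman[OF U(3) r] by blast
    from choice[OF this] obtain T where
      "\<forall>i. T i \<in> sets M \<and> {\<omega>\<in>E. x \<omega> \<in> U i} \<subseteq> T i \<and> emeasure M (T i) \<le> ennreal (C * r i powr s)"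
      by (elim exE)
    then have T: "T i \<in> sets M" "{\<omega>\<in>E. x \<omega> \<in> U i} \<subseteq> T i"
      "emeasure M (T i) \<le> ennreal (C * r i powr s)" for i
      by simp_all
    have r_powr: "ennreal (r i powr s) \<le> diam_power s (U i) + ennreal (\<eta> * (1/2) ^ Suc i)" for i
    proof -
      have "r i powr s \<le> diameter (U i) powr s + e i powr s"
        by (auto simp: r_def max_def)
      then have "ennreal (r i powr s) \<le> ennreal (diameter (U i) powr s + e i powr s)"
        by (rule ennreal_leI)
      also have "\<dots> = ennreal (diameter (U i) powr s) + ennreal (e i powr s)"
        by (rule ennreal_plus) simp_all
      finally show ?thesis
        by (simp only: dp e(3))
    qed
    have "E \<subseteq> (\<Union>i. T i)"
    proof
      fix \<omega> assume \<omega>: "\<omega> \<in> E"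
      then have "x \<omega> \<in> (\<Union>i. U i)" using in_S U(2) by (meson subsetD)
      then obtain i where "x \<omega> \<in> U i" by auto
      with \<omega> have "\<omega> \<in> T i" by (intro subsetD[OF T(2)]) simp
      then show "\<omega> \<in> (\<Union>i. T i)" by auto
    qed
    then have "emeasure M E \<le> emeasure M (\<Union>i. T i)"
      using T(1) by (intro emeasure_mono) auto
    also have "\<dots> \<le> (\<Sum>i. emeasure M (T i))"
      using T(1) by (intro emeasure_subadditive_countably) auto
    also have "\<dots> \<le> (\<Sum>i. ennreal C * (diam_power s (U i) + ennreal (\<eta> * (1/2) ^ Suc i)))"
    proof (intro suminf_le)
      show "emeasure M (T i) \<le> ennreal C * (diam_power s (U i) + ennreal (\<eta> * (1/2) ^ Suc i))" for i
      proof -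
        have "emeasure M (T i) \<le> ennreal C * ennreal (r i powr s)"
          using T(3)[of i] C by (simp add: ennreal_mult)
        also have "\<dots> \<le> ennreal C * (diam_power s (U i) + ennreal (\<eta> * (1/2) ^ Suc i))"
          by (intro mult_left_mono r_powr) simp
        finally show ?thesis .
      qed
    qed simp_all
    also have "\<dots> = ennreal C * ((\<Sum>i. diam_power s (U i)) + (\<Sum>i. ennreal (\<eta> * (1/2) ^ Suc i)))"
      by (subst ennreal_suminf_cmult, subst suminf_add) simp_all
    also have "(\<Sum>i. ennreal (\<eta> * (1/2) ^ Suc i)) = ennreal \<eta>"
    proof -
      have "(\<lambda>i. \<eta> * (1/2) ^ Suc i) sums (\<eta> * 1)"
        by (intro sums_mult power_half_series)
      then show ?thesis using \<eta> by (intro suminf_ennreal_eq) auto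
    qed
    also have "ennreal C * ((\<Sum>i. diam_power s (U i)) + ennreal \<eta>) \<le> ennreal C * (ennreal \<eta> + ennreal \<eta>)"
      using U(1) by (intro mult_left_mono add_right_mono) auto
    also have "ennreal \<eta> + ennreal \<eta> = ennreal (\<eta> + \<eta>)"
      using \<eta> by (intro ennreal_plus[symmetric]) simp_all
    also have "ennreal C * ennreal (\<eta> + \<eta>) = ennreal (C * (\<eta> + \<eta>))"
      using C \<eta> by (intro ennreal_mult[symmetric]) simp_all
    also have "C * (\<eta> + \<eta>) = 2 * C * \<eta>"
      by simp
    finally show ?thesis .
  qed
  have "emeasure M E \<le> 0"
  proof (rule tendsto_lowerbound)
    show "((\<lambda>\<eta>. ennreal (2 * C * \<eta>)) \<longlongrightarrow> 0) (at_right 0)"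
      unfolding ennreal_0[symmetric] by (intro tendsto_ennrealI) (auto intro!: tendsto_eq_intros)
    show "eventually (\<lambda>\<eta>. emeasure M E \<le> ennreal (2 * C * \<eta>)) (at_right 0)"
      unfolding eventually_at_right_field by (rule exI[of _ 1]) (auto intro: E)
  qed simp
  with pos show False by simp
qed

lemma hausdorff_measure_0_nonempty:
  assumes "S \<noteq> {}"
  shows "hausdorff_measure 0 S \<noteq> 0"
proof
  assume "hausdorff_measure 0 S = 0"
  moreover have "hausdorff_premeasure 1 0 S \<le> hausdorff_measure 0 S"
    unfolding hausdorff_measure_def by (rule SUP_upper) simp
  ultimately have "hausdorff_premeasure 1 0 S < 1" by simp
  then obtain U :: "nat \<Rightarrow> 'a set" where U: "(\<Sum>i. diam_power 0 (U i)) < 1" "S \<subseteq> (\<Union>i. U i)"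
    unfolding hausdorff_premeasure_def Inf_less_iff by auto
  obtain i where "U i \<noteq> {}" using U(2) assms by fastforce
  then have "1 = diam_power 0 (U i)" by (simp add: diam_power_def)
  also have "\<dots> \<le> (\<Sum>i. diam_power 0 (U i))"
    using sum_le_suminf[of "\<lambda>i. diam_power 0 (U i)" "{i}"] by simp
  finally show False using U(1) by simp
qed

section \<open>Words and interval geometry of a sponge\<close>

lemma words_0 [simp]: "words m 0 = {[]}"
  by (auto simp: words_def)

lemma words_Suc: "words m (Suc k) = (\<lambda>(v, i). v @ [i]) ` (SIGMA v:words m k. {1..m v})"
proof (intro equalityI subsetI)
  fix w assume w: "w \<in> words m (Suc k)"
  then have len: "length w = Suc k" and nth: "\<And>j. j < Suc k \<Longrightarrow> w ! j \<in> {1..m (take j w)}"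
    by (auto simp: words_def)
  have "w = take k w @ [w ! k]"
    using len by (simp add: take_Suc_conv_app_nth[symmetric])
  moreover have "take k w \<in> words m k" "w ! k \<in> {1..m (take k w)}"
    using len nth by (auto simp: words_def min_def)
  ultimately show "w \<in> (\<lambda>(v, i). v @ [i]) ` (SIGMA v:words m k. {1..m v})"
    by (intro image_eqI[of _ _ "(take k w, w ! k)"]) auto
next
  fix w assume "w \<in> (\<lambda>(v, i). v @ [i]) ` (SIGMA v:words m k. {1..m v})"
  then show "w \<in> words m (Suc k)"
    by (auto simp: words_def nth_append less_Suc_eq)
qed

lemma words_length: "w \<in> words m k \<Longrightarrow> length w = k"
  by (simp add: words_def)

lemma words_take: "w \<in> words m n \<Longrightarrow> k \<le> n \<Longrightarrow> take k w \<in> words m k"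
  by (auto simp: words_def min_def)

lemma finite_words: "finite (words m k)"
  by (induction k) (auto simp: words_Suc)

lemma sum_words_Suc:
  "(\<Sum>w\<in>words m (Suc k). g w) = (\<Sum>v\<in>words m k. \<Sum>i=1..m v. g (v @ [i]))"
proof -
  have "(\<Sum>w\<in>words m (Suc k). g w) = (\<Sum>(v, i)\<in>(SIGMA v:words m k. {1..m v}). g (v @ [i]))"
    unfolding words_Suc by (subst sum.reindex) (auto simp: inj_on_def intro!: sum.cong)
  also have "\<dots> = (\<Sum>v\<in>words m k. \<Sum>i=1..m v. g (v @ [i]))"
    by (subst sum.Sigma) (auto simp: finite_words)
  finally show ?thesis .
qed

context sponge_data
begin

lemma words_nonempty: "k \<le> d \<Longrightarrow> words m k \<noteq> {}"
proof (induction k)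
  case (Suc k)
  then obtain v where "v \<in> words m k" by auto
  moreover from this have "1 \<le> m v" using m_pos[of k v] Suc by auto
  ultimately have "v @ [1] \<in> words m (Suc k)" by (auto simp: words_Suc)
  then show ?case by auto
qed simp

lemma a_take_antimono:
  assumes "w \<in> words m d" "1 \<le> k" "k \<le> k'" "k' \<le> d"
  shows "a (take k' w) \<le> a (take k w)"
  using assms(3,4)
proof (induction k' rule: dec_induct)
  case (step n)
  have "take (Suc n) w = take n w @ [w ! n]" "w ! n \<in> {1..m (take n w)}"
    using assms(1) step by (auto simp: words_def take_Suc_conv_app_nth)
  then have "a (take (Suc n) w) \<le> a (take n w)"
    using a_decreasing[of n "take n w" "w ! n"] words_take[OF assms(1), of n] step assms(2) by auto
  then show ?case using step by simp
qed simp

lemma sibling_intervals_separated: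
  assumes v: "v \<in> words m k" and k: "k < d" and i: "1 \<le> i" "i < i'" "i' \<le> m v"
  shows "u (v @ [i]) + a (v @ [i]) \<le> u (v @ [i'])"
proof -
  have "Suc i \<le> i'" using i by simp
  then show ?thesis
    using i(3)
  proof (induction i' rule: dec_induct)
    case base
    then show ?case using u_gap[OF k v, of i] i by auto
  next
    case (step n)
    then have "u (v @ [n]) < u (v @ [n + 1])"
      using u_increasing[OF k v, of n] i by auto
    then show ?case using step by simp
  qed
qed

lemma interval_in_unit:
  assumes w: "w \<in> words m k" and k: "1 \<le> k" "k \<le> d"
  shows "0 \<le> u w" "u w + a w \<le> 1"
proof -
  obtain v i where vi: "w = v @ [i]" "v \<in> words m (k - 1)" "i \<in> {1..m v}"
    using w k words_Suc[of m "k - 1"] by auto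
  have k': "k - 1 < d" using k by simp
  show "u w + a w \<le> 1"
  proof (cases "i < m v")
    case True
    then have "i \<in> {1..<m v}" using vi by auto
    moreover have "v @ [i + 1] \<in> words m k"
      using vi(2,3) True k words_Suc[of m "k - 1"] by (auto intro!: image_eqI[of _ _ "(v, i + 1)"])
    ultimately show ?thesis
      using u_gap[OF k' vi(2), of i] u_range[of k "v @ [i + 1]"] k vi by auto
  next
    case False
    then have "i = m v" using vi by auto
    then show ?thesis using u_last[OF k' vi(2)] vi by auto
  qed
  show "0 \<le> u w" using u_range[of k w] w k by auto
qed

definition ratios :: "real set" where
  "ratios = (\<lambda>(k, w). a (take k w)) ` ({1..d} \<times> words m d)"

definition a_min :: real where "a_min = Min ratios"
definition a_max :: real where "a_max = Max ratios"

lemma finite_ratios: "finite ratios" and ratios_nonempty: "ratios \<noteq> {}"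
  using d_ge_2 words_nonempty[of d] finite_words[of m d] by (auto simp: ratios_def)

lemma a_min_le: "w \<in> words m d \<Longrightarrow> k \<in> {1..d} \<Longrightarrow> a_min \<le> a (take k w)"
  and a_max_ge: "w \<in> words m d \<Longrightarrow> k \<in> {1..d} \<Longrightarrow> a (take k w) \<le> a_max"
  using finite_ratios by (auto simp: a_min_def a_max_def ratios_def intro!: Min_le Max_ge image_eqI[of _ _ "(k, w)"])

lemma a_take_pos: "w \<in> words m d \<Longrightarrow> k \<in> {1..d} \<Longrightarrow> 0 < a (take k w)"
  using a_range[of k "take k w"] words_take[of w m d k] by auto

lemma a_min_pos: "0 < a_min" and a_max_less_1: "a_max < 1" and a_min_le_max: "a_min \<le> a_max"
proof -
  have *: "x \<in> ratios \<Longrightarrow> 0 < x \<and> x < 1" for x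
    using a_range words_take by (auto simp: ratios_def)
  have "a_min \<in> ratios" "a_max \<in> ratios"
    using finite_ratios ratios_nonempty by (auto simp: a_min_def a_max_def)
  then show "0 < a_min" "a_max < 1" using * by auto
  show "a_min \<le> a_max"
    using \<open>a_min \<in> ratios\<close> finite_ratios by (auto simp: a_max_def)
qed

definition seqs :: "(nat \<Rightarrow> nat list) set" where
  "seqs = {\<omega>. \<forall>j. \<omega> j \<in> words m d}"

text \<open>
  A sequence \<open>\<omega>\<close> of letters codes a point.  At level \<open>k\<close> only the prefixes
  \<open>take k (\<omega> j)\<close> matter: after \<open>n\<close> letters the coordinate at level \<open>k\<close>, which is number
  \<open>d + 1 - k\<close> in the original order, is known to lie in the interval of length
  \<open>contraction k \<omega> n\<close> whose left end point is \<open>corner k \<omega> n\<close>.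
\<close>

definition contraction :: "nat \<Rightarrow> (nat \<Rightarrow> nat list) \<Rightarrow> nat \<Rightarrow> real" where
  "contraction k \<omega> n = (\<Prod>j<n. a (take k (\<omega> j)))"

definition corner :: "nat \<Rightarrow> (nat \<Rightarrow> nat list) \<Rightarrow> nat \<Rightarrow> real" where
  "corner k \<omega> n = (\<Sum>j<n. contraction k \<omega> j * u (take k (\<omega> j)))"

definition coding :: "nat \<Rightarrow> (nat \<Rightarrow> nat list) \<Rightarrow> real" where
  "coding k \<omega> = lim (corner k \<omega>)"

text \<open>
  The levels contract at different speeds, so to obtain a box all of whose sides
  are comparable to \<open>r\<close> the prefix of length \<open>k\<close> has to be fixed for its own number
  \<open>depth r k \<omega>\<close> of letters.  Since \<open>a\<close> decreases along prefixes, this number decreases in \<open>k\<close>.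
\<close>

definition depth :: "real \<Rightarrow> nat \<Rightarrow> (nat \<Rightarrow> nat list) \<Rightarrow> nat" where
  "depth r k \<omega> = (LEAST n. contraction k \<omega> n \<le> r)"

definition cube :: "real \<Rightarrow> (nat \<Rightarrow> nat list) \<Rightarrow> (nat \<Rightarrow> nat list) set" where
  "cube r \<omega> = {\<omega>'. \<forall>k\<in>{1..d}. \<forall>j<depth r k \<omega>. take k (\<omega>' j) = take k (\<omega> j)}"

lemma seqsD: "\<omega> \<in> seqs \<Longrightarrow> \<omega> j \<in> words m d"
  by (simp add: seqs_def)

lemma contraction_0 [simp]: "contraction k \<omega> 0 = 1"
  and contraction_Suc: "contraction k \<omega> (Suc n) = contraction k \<omega> n * a (take k (\<omega> n))"
  and corner_0 [simp]: "corner k \<omega> 0 = 0"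
  and corner_Suc: "corner k \<omega> (Suc n) = corner k \<omega> n + contraction k \<omega> n * u (take k (\<omega> n))"
  by (simp_all add: contraction_def corner_def)

lemma contraction_pos: "\<omega> \<in> seqs \<Longrightarrow> k \<in> {1..d} \<Longrightarrow> 0 < contraction k \<omega> n"
  unfolding contraction_def by (intro prod_pos) (simp add: a_take_pos seqsD)

lemma contraction_le_power: "\<omega> \<in> seqs \<Longrightarrow> k \<in> {1..d} \<Longrightarrow> contraction k \<omega> n \<le> a_max ^ n"
  unfolding contraction_def
  using prod_mono[of "{..<n}" "\<lambda>j. a (take k (\<omega> j))" "\<lambda>_. a_max"]
  by (simp add: a_max_ge a_take_pos less_imp_le seqsD)

lemma contraction_antimono_level:
  "\<omega> \<in> seqs \<Longrightarrow> 1 \<le> k \<Longrightarrow> k \<le> k' \<Longrightarrow> k' \<le> d \<Longrightarrow> contraction k' \<omega> n \<le> contraction k \<omega> n"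
  unfolding contraction_def
  by (intro prod_mono) (auto simp: a_take_antimono seqsD intro!: less_imp_le[OF a_take_pos])

lemma contraction_tendsto_0:
  assumes "\<omega> \<in> seqs" "k \<in> {1..d}"
  shows "contraction k \<omega> \<longlonglongrightarrow> 0"
proof (rule tendsto_sandwich[of "\<lambda>_. 0" _ _ "\<lambda>n. a_max ^ n"])
  show "(\<lambda>n. a_max ^ n) \<longlonglongrightarrow> 0"
    using a_min_pos a_max_less_1 a_min_le_max by (intro LIMSEQ_power_zero) auto
qed (use contraction_le_power[OF assms] less_imp_le[OF contraction_pos[OF assms]] in \<open>auto intro!: always_eventually\<close>)

lemma corner_mono:
  assumes "\<omega> \<in> seqs" "k \<in> {1..d}" "n \<le> n'"
  shows "corner k \<omega> n \<le> corner k \<omega> n'"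
proof (rule lift_Suc_mono_le[OF _ assms(3)])
  fix n
  have "0 \<le> u (take k (\<omega> n))"
    using interval_in_unit(1)[OF words_take[OF seqsD[OF assms(1)]]] assms(2) by auto
  then show "corner k \<omega> n \<le> corner k \<omega> (Suc n)"
    using contraction_pos[OF assms(1,2), of n] by (simp add: corner_Suc)
qed

lemma upper_corner_antimono:
  assumes "\<omega> \<in> seqs" "k \<in> {1..d}" "n \<le> n'"
  shows "corner k \<omega> n' + contraction k \<omega> n' \<le> corner k \<omega> n + contraction k \<omega> n"
proof (rule lift_Suc_antimono_le[OF _ assms(3)])
  fix n
  have "u (take k (\<omega> n)) + a (take k (\<omega> n)) \<le> 1"
    using interval_in_unit(2)[OF words_take[OF seqsD[OF assms(1)]]] assms(2) by auto
  then have "contraction k \<omega> n * (u (take k (\<omega> n)) + a (take k (\<omega> n))) \<le> contraction k \<omega> n * 1"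
    using contraction_pos[OF assms(1,2), of n] by (intro mult_left_mono) auto
  then show "corner k \<omega> (Suc n) + contraction k \<omega> (Suc n) \<le> corner k \<omega> n + contraction k \<omega> n"
    by (simp add: corner_Suc contraction_Suc algebra_simps)
qed

lemma corner_tendsto_coding:
  assumes "\<omega> \<in> seqs" "k \<in> {1..d}"
  shows "corner k \<omega> \<longlonglongrightarrow> coding k \<omega>"
proof -
  have "convergent (corner k \<omega>)"
  proof (rule Bseq_mono_convergent)
    have "0 \<le> corner k \<omega> n" "corner k \<omega> n \<le> 1" for n
      using corner_mono[OF assms, of 0 n] upper_corner_antimono[OF assms, of 0 n]
        contraction_pos[OF assms, of n] by auto
    then show "Bseq (corner k \<omega>)"
      by (intro BseqI'[of _ 1]) auto
  qed (use corner_mono[OF assms] in auto)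
  then show ?thesis
    unfolding coding_def by (simp add: convergent_LIMSEQ_iff)
qed

lemma coding_in_interval:
  assumes "\<omega> \<in> seqs" "k \<in> {1..d}"
  shows "corner k \<omega> n \<le> coding k \<omega>" "coding k \<omega> \<le> corner k \<omega> n + contraction k \<omega> n"
proof -
  show "corner k \<omega> n \<le> coding k \<omega>"
    by (rule LIMSEQ_le_const[OF corner_tendsto_coding[OF assms]]) (use corner_mono[OF assms] in blast)
  show "coding k \<omega> \<le> corner k \<omega> n + contraction k \<omega> n"
  proof (rule LIMSEQ_le_const2[OF corner_tendsto_coding[OF assms]], intro exI allI impI)
    fix n' assume "n \<le> n'"
    then show "corner k \<omega> n' \<le> corner k \<omega> n + contraction k \<omega> n"
      using upper_corner_antimono[OF assms, of n n'] contraction_pos[OF assms, of n'] by simp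
  qed
qed

lemma contraction_depth_le:
  assumes "\<omega> \<in> seqs" "k \<in> {1..d}" "0 < r"
  shows "contraction k \<omega> (depth r k \<omega>) \<le> r"
proof -
  have "eventually (\<lambda>n. contraction k \<omega> n < r) sequentially"
    using contraction_tendsto_0[OF assms(1,2)] assms(3) by (simp add: order_tendstoD)
  then obtain n where "contraction k \<omega> n < r"
    using eventually_happens'[OF sequentially_bot] by blast
  then show ?thesis unfolding depth_def by (rule LeastI[of "\<lambda>n. contraction k \<omega> n \<le> r" n, OF less_imp_le])
qed

lemma depth_le: "contraction k \<omega> n \<le> r \<Longrightarrow> depth r k \<omega> \<le> n"
  unfolding depth_def by (rule Least_le)

lemma contraction_depth_gt:
  assumes "\<omega> \<in> seqs" "k \<in> {1..d}" "0 < r" "r \<le> 1"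
  shows "a_min * r < contraction k \<omega> (depth r k \<omega>)"
proof (cases "depth r k \<omega>")
  case 0
  then have "r = 1" using contraction_depth_le[OF assms(1-3)] assms by simp
  then show ?thesis using 0 a_min_le_max a_max_less_1 by simp
next
  case (Suc n)
  have "r < contraction k \<omega> n"
    by (rule ccontr) (use depth_le[of k \<omega> n r] Suc in simp)
  then have "a_min * r < a_min * contraction k \<omega> n"
    using a_min_pos by simp
  also have "\<dots> \<le> a (take k (\<omega> n)) * contraction k \<omega> n"
    using contraction_pos[OF assms(1,2), of n]
    by (intro mult_right_mono a_min_le seqsD assms(1,2)) simp
  finally show ?thesis using Suc by (simp add: contraction_Suc mult.commute)
qed

lemma depth_antimono_level:
  assumes "\<omega> \<in> seqs" "1 \<le> k" "k \<le> k'" "k' \<le> d" "0 < r"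
  shows "depth r k' \<omega> \<le> depth r k \<omega>"
proof (rule depth_le)
  have "k \<in> {1..d}" using assms by simp
  then show "contraction k' \<omega> (depth r k \<omega>) \<le> r"
    using contraction_antimono_level[OF assms(1-4), of "depth r k \<omega>"]
      contraction_depth_le[OF assms(1) _ assms(5), of k] by simp
qed

lemma depth_bound:
  assumes "\<omega> \<in> seqs" "k \<in> {1..d}" "0 < r" "r \<le> 1"
  shows "real (depth r k \<omega>) * - ln a_max \<le> - ln r - ln a_min"
proof -
  have "a_min * r \<le> a_max ^ depth r k \<omega>"
    using contraction_depth_gt[OF assms] contraction_le_power[OF assms(1,2), of "depth r k \<omega>"] by simp
  then have "ln (a_min * r) \<le> ln (a_max ^ depth r k \<omega>)"
    by (rule ln_mono) (use a_min_pos assms(3) in simp_all)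
  moreover have "ln (a_min * r) = ln a_min + ln r"
    using a_min_pos assms(3) by (rule ln_mult_pos)
  moreover have "ln (a_max ^ depth r k \<omega>) = real (depth r k \<omega>) * ln a_max"
    by (rule ln_realpow)
  ultimately show ?thesis by (simp only: mult_minus_right)
qed

text \<open>
  Two sequences that have the same parent prefixes lie, from the first place at which they differ at
  level \<open>Suc k\<close>, in different sibling intervals, which do not overlap; deeper intervals are nested in
  these.
\<close>

lemma intervals_separated_at_branching:
  assumes \<omega>: "\<omega> \<in> seqs" and \<omega>': "\<omega>' \<in> seqs" and k: "Suc k \<le> d"
    and eq: "\<And>i. i < j \<Longrightarrow> take (Suc k) (\<omega> i) = take (Suc k) (\<omega>' i)"
    and parent: "take k (\<omega> j) = take k (\<omega>' j)"
    and less: "\<omega> j ! k < \<omega>' j ! k"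
    and j: "j < n" "j < n'"
  shows "corner (Suc k) \<omega> n + contraction (Suc k) \<omega> n \<le> corner (Suc k) \<omega>' n'"
proof -
  define v where "v = take k (\<omega> j)"
  have w: "\<omega> j \<in> words m d" "\<omega>' j \<in> words m d" using \<omega> \<omega>' by (auto simp: seqsD)
  have v: "v \<in> words m k" using w k by (auto simp: v_def words_take)
  have ext: "take (Suc k) (\<omega> j) = v @ [\<omega> j ! k]" "take (Suc k) (\<omega>' j) = v @ [\<omega>' j ! k]"
    using w k parent by (auto simp: v_def take_Suc_conv_app_nth words_length)
  have range: "\<omega> j ! k \<ge> 1" "\<omega>' j ! k \<le> m v"
    using w k parent by (auto simp: words_def v_def)
  have c: "contraction (Suc k) \<omega> j = contraction (Suc k) \<omega>' j"
    unfolding contraction_def using eq by (intro prod.cong) auto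
  have s: "corner (Suc k) \<omega> j = corner (Suc k) \<omega>' j"
    unfolding corner_def contraction_def using eq by (intro sum.cong arg_cong2[of _ _ _ _ "(*)"] prod.cong) auto
  have "corner (Suc k) \<omega> n + contraction (Suc k) \<omega> n
      \<le> corner (Suc k) \<omega> (Suc j) + contraction (Suc k) \<omega> (Suc j)"
    using upper_corner_antimono[OF \<omega>, of "Suc k" "Suc j" n] k j by auto
  also have "\<dots> = corner (Suc k) \<omega> j + contraction (Suc k) \<omega> j * (u (v @ [\<omega> j ! k]) + a (v @ [\<omega> j ! k]))"
    by (simp add: corner_Suc contraction_Suc ext algebra_simps)
  also have "\<dots> \<le> corner (Suc k) \<omega> j + contraction (Suc k) \<omega> j * u (v @ [\<omega>' j ! k])"
    using sibling_intervals_separated[OF v _ range(1) less range(2)] k contraction_pos[OF \<omega>, of "Suc k" j]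
    by (intro add_left_mono mult_left_mono) auto
  also have "\<dots> = corner (Suc k) \<omega>' (Suc j)"
    by (simp add: corner_Suc ext c s)
  also have "\<dots> \<le> corner (Suc k) \<omega>' n'"
    using corner_mono[OF \<omega>', of "Suc k" "Suc j" n'] k j by auto
  finally show ?thesis .
qed

text \<open>
  The depth is a stopping time: a sequence with the prefixes that the depth of \<open>\<omega>\<close> selects has been
  contracted as much at that place, so it stops there at the latest.
\<close>

lemma depth_le_if_prefixes_agree:
  assumes "\<omega> \<in> seqs" "\<omega>' \<in> seqs" "k \<in> {1..d}" "0 < r"
    and "\<And>j. j < depth r k \<omega> \<Longrightarrow> take k (\<omega> j) = take k (\<omega>' j)"
  shows "depth r k \<omega>' \<le> depth r k \<omega>"
proof (rule depth_le)
  have "contraction k \<omega>' (depth r k \<omega>) = contraction k \<omega> (depth r k \<omega>)"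
    unfolding contraction_def by (intro prod.cong refl arg_cong[of _ _ a] assms(5)[symmetric]) simp
  then show "contraction k \<omega>' (depth r k \<omega>) \<le> r"
    using contraction_depth_le[OF assms(1,3,4)] by (simp only:)
qed

text \<open>
  As the depth is a stopping time, the selected prefixes of two sequences cannot be comparable
  without being equal; so if they are not equal, they differ within both depths.
\<close>

lemma agree_or_intervals_separated:
  assumes \<omega>: "\<omega> \<in> seqs" and \<omega>': "\<omega>' \<in> seqs" and k: "Suc k \<le> d" and r: "0 < r"
    and parent: "\<And>j. j < depth r (Suc k) \<omega> \<Longrightarrow> take k (\<omega> j) = take k (\<omega>' j)"
  defines "n \<equiv> depth r (Suc k) \<omega>" and "n' \<equiv> depth r (Suc k) \<omega>'"
  shows "(n = n' \<and> (\<forall>j<n. take (Suc k) (\<omega> j) = take (Suc k) (\<omega>' j)))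
    \<or> corner (Suc k) \<omega> n + contraction (Suc k) \<omega> n \<le> corner (Suc k) \<omega>' n'
    \<or> corner (Suc k) \<omega>' n' + contraction (Suc k) \<omega>' n' \<le> corner (Suc k) \<omega> n"
proof (cases "\<forall>j<min n n'. take (Suc k) (\<omega> j) = take (Suc k) (\<omega>' j)")
  case True
  have "n = n'"
  proof (cases "n \<le> n'")
    case le: True
    have "n' \<le> n"
      unfolding n_def n'_def
    proof (rule depth_le_if_prefixes_agree[OF \<omega> \<omega>' _ r])
      fix j assume "j < depth r (Suc k) \<omega>"
      then have "j < min n n'" using le by (simp add: n_def)
      then show "take (Suc k) (\<omega> j) = take (Suc k) (\<omega>' j)" using True by blast
    qed (use k in simp)
    with le show ?thesis by simp
  next
    case False
    have "n \<le> n'"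
      unfolding n_def n'_def
    proof (rule depth_le_if_prefixes_agree[OF \<omega>' \<omega> _ r])
      fix j assume "j < depth r (Suc k) \<omega>'"
      then have "j < min n n'" using False by (simp add: n'_def)
      then show "take (Suc k) (\<omega>' j) = take (Suc k) (\<omega> j)" using True by auto
    qed (use k in simp)
    with False show ?thesis by simp
  qed
  with True show ?thesis by simp
next
  case False
  define j where "j = (LEAST j. j < min n n' \<and> take (Suc k) (\<omega> j) \<noteq> take (Suc k) (\<omega>' j))"
  have "j < min n n' \<and> take (Suc k) (\<omega> j) \<noteq> take (Suc k) (\<omega>' j)"
    unfolding j_def by (rule LeastI_ex) (use False in auto)
  then have j: "j < n" "j < n'" "take (Suc k) (\<omega> j) \<noteq> take (Suc k) (\<omega>' j)" by auto
  have eq: "take (Suc k) (\<omega> i) = take (Suc k) (\<omega>' i)" if "i < j" for i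
    using not_less_Least[OF that[unfolded j_def]] that j(1,2) by simp
  have par: "take k (\<omega> j) = take k (\<omega>' j)" using parent j by (simp add: n_def)
  have "\<omega> j \<in> words m d" "\<omega>' j \<in> words m d" using \<omega> \<omega>' by (auto simp: seqsD)
  then have "\<omega> j ! k \<noteq> \<omega>' j ! k"
    using j(3) par k by (auto simp: take_Suc_conv_app_nth words_length)
  then consider "\<omega> j ! k < \<omega>' j ! k" | "\<omega>' j ! k < \<omega> j ! k" by linarith
  then show ?thesis
  proof cases
    case 1
    then show ?thesis
      using intervals_separated_at_branching[OF \<omega> \<omega>' k eq par 1 j(1,2)] by (intro disjI2 disjI1)
  next
    case 2
    then show ?thesis
      using intervals_separated_at_branching[OF \<omega>' \<omega> k eq[symmetric] par[symmetric] 2 j(2,1)] by (intro disjI2)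
  qed
qed

section \<open>Approximate cubes near a set\<close>

definition grid_index :: "real \<Rightarrow> nat \<Rightarrow> (nat \<Rightarrow> nat list) \<Rightarrow> int" where
  "grid_index r k \<omega> = \<lfloor>corner k \<omega> (depth r k \<omega>) / (a_min * r)\<rfloor>"

text \<open>
  Sequences with different cubes have a first level at which the selected prefixes differ.  There the
  parent prefixes agree, so the two side intervals do not overlap; as both are longer than
  \<open>a_min * r\<close>, their left end points fall into different cells of the grid with that mesh.  Hence
  the vector of grid indices determines the cube, which allows cubes to be counted by counting
  integer vectors.
\<close>

lemma cube_eqI_grid_index:
  assumes \<omega>: "\<omega> \<in> seqs" and \<omega>': "\<omega>' \<in> seqs" and r: "0 < r" "r \<le> 1"
    and grid: "\<And>k. k \<in> {1..d} \<Longrightarrow> grid_index r k \<omega> = grid_index r k \<omega>'"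
  shows "cube r \<omega> = cube r \<omega>'"
proof -
  have pos: "0 < a_min * r" using a_min_pos r by simp
  have floor_less: "\<lfloor>x / (a_min * r)\<rfloor> < \<lfloor>y / (a_min * r)\<rfloor>" if "x + h \<le> y" "a_min * r < h" for x y h :: real
  proof -
    have "x / (a_min * r) + 1 = (x + a_min * r) / (a_min * r)"
      using a_min_pos r by (simp add: add_divide_distrib)
    also have "\<dots> \<le> y / (a_min * r)"
      using that pos by (intro divide_right_mono) auto
    finally show ?thesis by linarith
  qed
  have agree: "depth r k \<omega> = depth r k \<omega>' \<and> (\<forall>j<depth r k \<omega>. take k (\<omega> j) = take k (\<omega>' j))"
    if "k \<in> {1..d}" for k
    using that
  proof (induction k)
    case (Suc k)
    have parent: "take k (\<omega> j) = take k (\<omega>' j)" if "j < depth r (Suc k) \<omega>" for j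
    proof (cases "k = 0")
      case False
      then have "j < depth r k \<omega>"
        using depth_antimono_level[OF \<omega>, of k "Suc k" r] Suc.prems r that by auto
      then show ?thesis using Suc False by auto
    qed simp
    let ?c = "contraction (Suc k)"
    \<comment> \<open>Separated side intervals would force different grid indices.\<close>
    have "\<not> corner (Suc k) \<omega> (depth r (Suc k) \<omega>) + ?c \<omega> (depth r (Suc k) \<omega>)
             \<le> corner (Suc k) \<omega>' (depth r (Suc k) \<omega>')"
      "\<not> corner (Suc k) \<omega>' (depth r (Suc k) \<omega>') + ?c \<omega>' (depth r (Suc k) \<omega>')
             \<le> corner (Suc k) \<omega> (depth r (Suc k) \<omega>)"
      using floor_less contraction_depth_gt[OF \<omega> Suc.prems r] contraction_depth_gt[OF \<omega>' Suc.prems r]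
        grid[OF Suc.prems] unfolding grid_index_def by (metis less_irrefl)+
    then show ?case
      using agree_or_intervals_separated[OF \<omega> \<omega>' _ r(1) parent] Suc.prems by auto
  qed simp
  then show ?thesis by (auto simp: cube_def)
qed

definition max_cubes :: nat where
  "max_cubes = (nat \<lceil>3 / a_min\<rceil> + 2) ^ d"

text \<open>
  At each level the left end point lies in an interval of length \<open>3 r\<close>, which meets at most
  \<open>3 / a_min + 2\<close> cells of the grid.  The bound is independent of \<open>r\<close>, so balls can be replaced by
  approximate cubes in dimension estimates.
\<close>

lemma card_cubes_le:
  assumes F: "F \<subseteq> seqs" and r: "0 < r" "r \<le> 1"
    and close: "\<And>\<omega> \<omega>' k. \<omega> \<in> F \<Longrightarrow> \<omega>' \<in> F \<Longrightarrow> k \<in> {1..d} \<Longrightarrow> \<bar>coding k \<omega> - coding k \<omega>'\<bar> \<le> r"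
  shows "finite (cube r ` F) \<and> card (cube r ` F) \<le> max_cubes"
proof (cases "F = {}")
  case False
  then obtain \<omega>0 where \<omega>0: "\<omega>0 \<in> F" by auto
  define G where "G \<omega> = (\<lambda>k\<in>{1..d}. grid_index r k \<omega>)" for \<omega>
  define I where "I k = {\<lfloor>coding k \<omega>0 / (a_min * r) - 2 / a_min\<rfloor>..\<lfloor>coding k \<omega>0 / (a_min * r) + 1 / a_min\<rfloor>}" for k
  have pos: "0 < a_min * r" using a_min_pos r by simp
  have G_in: "G \<omega> \<in> Pi\<^sub>E {1..d} I" if "\<omega> \<in> F" for \<omega>
  proof -
    have "grid_index r k \<omega> \<in> I k" if k: "k \<in> {1..d}" for k
    proof -
      have \<omega>: "\<omega> \<in> seqs" using F \<open>\<omega> \<in> F\<close> by auto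
      define x where "x = corner k \<omega> (depth r k \<omega>)"
      have "coding k \<omega> - r \<le> x" "x \<le> coding k \<omega>"
        using coding_in_interval[OF \<omega> k, of "depth r k \<omega>"] contraction_depth_le[OF \<omega> k r(1)]
        by (auto simp: x_def)
      then have "coding k \<omega>0 - 2 * r \<le> x" "x \<le> coding k \<omega>0 + r"
        using close[OF \<open>\<omega> \<in> F\<close> \<omega>0 k] by auto
      then have "(coding k \<omega>0 - 2 * r) / (a_min * r) \<le> x / (a_min * r)"
        "x / (a_min * r) \<le> (coding k \<omega>0 + r) / (a_min * r)"
        using pos by (auto intro!: divide_right_mono)
      then have "coding k \<omega>0 / (a_min * r) - 2 / a_min \<le> x / (a_min * r)"
        "x / (a_min * r) \<le> coding k \<omega>0 / (a_min * r) + 1 / a_min"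
        using r a_min_pos by (simp_all add: diff_divide_distrib add_divide_distrib)
      then show ?thesis
        unfolding grid_index_def I_def x_def[symmetric] by (auto intro: floor_mono)
    qed
    then show ?thesis by (auto simp: G_def)
  qed
  have fin_PiE: "finite (Pi\<^sub>E {1..d} I)"
    by (intro finite_PiE) (simp_all add: I_def)
  have sub: "G ` F \<subseteq> Pi\<^sub>E {1..d} I"
    using G_in by (rule image_subsetI)
  have fin: "finite (G ` F)" and "card (G ` F) \<le> card (Pi\<^sub>E {1..d} I)"
    by (rule finite_subset[OF sub fin_PiE], rule card_mono[OF fin_PiE sub])
  note this(2)
  also have "card (Pi\<^sub>E {1..d} I) = (\<Prod>k\<in>{1..d}. card (I k))"
    by (simp add: card_PiE)
  also have "\<dots> \<le> (\<Prod>k\<in>{1..d}. nat \<lceil>3 / a_min\<rceil> + 2)"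
  proof (intro prod_mono conjI)
    fix k
    have "real_of_int (\<lfloor>coding k \<omega>0 / (a_min * r) + 1 / a_min\<rfloor> - \<lfloor>coding k \<omega>0 / (a_min * r) - 2 / a_min\<rfloor> + 1)
      \<le> 3 / a_min + 2"
      by (simp add: diff_divide_distrib add_divide_distrib) linarith
    also have "\<dots> \<le> real_of_int (\<lceil>3 / a_min\<rceil> + 2)" by simp
    finally have "\<lfloor>coding k \<omega>0 / (a_min * r) + 1 / a_min\<rfloor> - \<lfloor>coding k \<omega>0 / (a_min * r) - 2 / a_min\<rfloor> + 1
      \<le> \<lceil>3 / a_min\<rceil> + 2" by (simp only: of_int_le_iff)
    then show "card (I k) \<le> nat \<lceil>3 / a_min\<rceil> + 2"
      unfolding I_def by simp
  qed simp
  also have "\<dots> = max_cubes" by (simp add: max_cubes_def)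
  finally have card_G: "card (G ` F) \<le> max_cubes" .
  define H where "H g = cube r (SOME \<omega>. \<omega> \<in> F \<and> G \<omega> = g)" for g
  have "cube r \<omega> = H (G \<omega>)" if "\<omega> \<in> F" for \<omega>
  proof -
    define \<omega>' where "\<omega>' = (SOME \<omega>'. \<omega>' \<in> F \<and> G \<omega>' = G \<omega>)"
    have "\<omega>' \<in> F \<and> G \<omega>' = G \<omega>"
      unfolding \<omega>'_def by (rule someI[of _ \<omega>]) (use that in auto)
    moreover from this have "grid_index r k \<omega> = grid_index r k \<omega>'" if "k \<in> {1..d}" for k
      using that unfolding G_def by (metis restrict_apply')
    ultimately have "cube r \<omega> = cube r \<omega>'"
      using F that r by (intro cube_eqI_grid_index) auto
    then show ?thesis by (simp add: H_def \<omega>'_def)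
  qed
  then have "cube r ` F = H ` G ` F"
    by (auto simp: image_image)
  then show ?thesis
    using fin card_G card_image_le[OF fin, of H] by auto
qed simp

text \<open>
  The coded point is the limit of the images of any point of \<open>\<Lambda>\<close> under the maps
  \<open>A\<^sub>0 \<circ> \<dots> \<circ> A\<^sub>n\<close>, all of which lie in the closed set \<open>\<Lambda>\<close>.
\<close>

lemma coding_in_sponge:
  fixes pos :: "'n::finite \<Rightarrow> nat" and \<Lambda> :: "(real ^ 'n) set"
  assumes pos: "bij_betw pos UNIV {1..d}" and sponge: "is_sponge d m a u pos \<Lambda>" and \<omega>: "\<omega> \<in> seqs"
  shows "(\<chi> c. coding (d + 1 - pos c) \<omega>) \<in> \<Lambda>"
proof -
  have level: "d + 1 - pos c \<in> {1..d}" for c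
  proof -
    have "pos c \<in> {1..d}" using bij_betwE[OF pos] by blast
    then show ?thesis by auto
  qed
  have iterate: "(\<chi> c. corner (d + 1 - pos c) \<omega> n + contraction (d + 1 - pos c) \<omega> n * z $ c) \<in> \<Lambda>"
    if "z \<in> \<Lambda>" for n z
    using that
  proof (induction n arbitrary: z)
    case (Suc n)
    have "sponge_map d a u pos (\<omega> n) z \<in> (\<Union>w\<in>words m d. sponge_map d a u pos w ` \<Lambda>)"
      using Suc.prems seqsD[OF \<omega>] by blast
    moreover have "(\<Union>w\<in>words m d. sponge_map d a u pos w ` \<Lambda>) = \<Lambda>"
      using sponge unfolding is_sponge_def by (elim conjE) (rule sym)
    ultimately have "sponge_map d a u pos (\<omega> n) z \<in> \<Lambda>"
      by (simp only:)
    from Suc.IH[OF this] show ?case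
      by (simp add: sponge_map_def corner_Suc contraction_Suc algebra_simps)
  qed simp
  obtain z where z: "z \<in> \<Lambda>" using sponge by (auto simp: is_sponge_def)
  have closed: "closed \<Lambda>" using sponge by (auto simp: is_sponge_def compact_imp_closed)
  have lim: "(\<lambda>n. \<chi> c. corner (d + 1 - pos c) \<omega> n + contraction (d + 1 - pos c) \<omega> n * z $ c)
      \<longlonglongrightarrow> (\<chi> c. coding (d + 1 - pos c) \<omega>)"
  proof (rule tendsto_vec_lambda)
    fix c
    have "(\<lambda>n. corner (d + 1 - pos c) \<omega> n + contraction (d + 1 - pos c) \<omega> n * z $ c)
      \<longlonglongrightarrow> coding (d + 1 - pos c) \<omega> + 0 * z $ c"
      by (intro tendsto_intros corner_tendsto_coding contraction_tendsto_0 \<omega> level)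
    then show "(\<lambda>n. corner (d + 1 - pos c) \<omega> n + contraction (d + 1 - pos c) \<omega> n * z $ c)
      \<longlonglongrightarrow> coding (d + 1 - pos c) \<omega>" by simp
  qed
  show ?thesis
    by (rule closed_sequentially[OF closed iterate[OF z] lim])
qed

end

section \<open>The dimension of a Bernoulli measure\<close>

definition prefix_prob :: "nat list pmf \<Rightarrow> nat \<Rightarrow> nat list \<Rightarrow> real" where
  "prefix_prob P k w = measure (measure_pmf P) {w'. take k w' = take k w}"

lemma prefix_prob_0 [simp]: "prefix_prob P 0 w = 1"
  by (simp add: prefix_prob_def)

lemma prefix_prob_pos: "w \<in> set_pmf P \<Longrightarrow> 0 < prefix_prob P k w"
  unfolding prefix_prob_def by (rule measure_pmf_posI[of w]) auto

lemma prod_prefix_prob_ratio: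
  assumes "w \<in> set_pmf P"
  shows "(\<Prod>k=1..n. prefix_prob P k w / prefix_prob P (k - 1) w) = prefix_prob P n w"
  using prefix_prob_pos[OF assms] by (induction n) (simp_all add: less_imp_neq[symmetric])

context sponge_data
begin

text \<open>
  The information \<open>- ln (q\<^sub>k / q\<^sub>k\<^sub>-\<^sub>1)\<close> that the \<open>k\<close>-th index of a letter adds to the previous ones,
  minus \<open>lam k\<close> times the expansion \<open>- ln a\<close> at level \<open>k\<close>.  Its mean vanishes exactly when \<open>lam k\<close> is
  the ratio of conditional entropy to Lyapunov exponent at level \<open>k\<close>.
\<close>

definition info_gap :: "nat list pmf \<Rightarrow> (nat \<Rightarrow> real) \<Rightarrow> nat \<Rightarrow> nat list \<Rightarrow> real" where
  "info_gap P lam k w =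
     lam k * ln (a (take k w)) - (ln (prefix_prob P k w) - ln (prefix_prob P (k - 1) w))"

text \<open>
  In a cube, the letter at place \<open>j\<close> has a prescribed prefix, whose length is the largest level \<open>k\<close>
  with \<open>j < depth r k \<omega>\<close>.  Writing the probability of that prefix as a telescoping product over the
  levels and exchanging the products separates the levels.
\<close>

lemma
  fixes P :: "nat list pmf"
  defines "M \<equiv> Pi\<^sub>M UNIV (\<lambda>_::nat. measure_pmf P)"
  assumes \<omega>: "\<omega> \<in> seqs" "\<And>j. \<omega> j \<in> set_pmf P" and r: "0 < r"
  shows cube_measurable: "cube r \<omega> \<in> sets M"
    and emeasure_cube: "emeasure M (cube r \<omega>) =
      ennreal (\<Prod>k=1..d. \<Prod>j<depth r k \<omega>. prefix_prob P k (\<omega> j) / prefix_prob P (k - 1) (\<omega> j))"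
proof -
  interpret product_prob_space "\<lambda>_::nat. measure_pmf P" UNIV
    by unfold_locales
  define J where "J = {..<depth r 1 \<omega>}"
  define B where "B j = {w. \<forall>k\<in>{k\<in>{1..d}. j < depth r k \<omega>}. take k w = take k (\<omega> j)}" for j
  have depth_le_1: "depth r k \<omega> \<le> depth r 1 \<omega>" if "k \<in> {1..d}" for k
    using depth_antimono_level[OF \<omega>(1), of 1 k r] that r by simp
  have cube_eq: "cube r \<omega> = {\<omega>' \<in> space M. \<forall>j\<in>J. \<omega>' j \<in> B j}"
    using depth_le_1 by (fastforce simp: cube_def M_def space_PiM B_def J_def)
  show "cube r \<omega> \<in> sets M"
    unfolding cube_eq M_def J_def by measurable
  have B: "emeasure (measure_pmf P) (B j) =
      ennreal (\<Prod>k\<in>{k\<in>{1..d}. j < depth r k \<omega>}. prefix_prob P k (\<omega> j) / prefix_prob P (k - 1) (\<omega> j))" for j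
  proof -
    \<comment> \<open>The depths decrease in the level, so the levels reaching place \<open>j\<close> are \<open>{1..n}\<close>.\<close>
    define n where "n = Max (insert 0 {k\<in>{1..d}. j < depth r k \<omega>})"
    have n_in: "n = 0 \<or> (n \<in> {1..d} \<and> j < depth r n \<omega>)"
      using Max_in[of "insert 0 {k\<in>{1..d}. j < depth r k \<omega>}"] by (auto simp: n_def)
    have levels: "{k\<in>{1..d}. j < depth r k \<omega>} = {1..n}"
    proof (intro equalityI subsetI)
      fix k assume "k \<in> {k\<in>{1..d}. j < depth r k \<omega>}"
      then show "k \<in> {1..n}" unfolding n_def by auto
    next
      fix k assume k: "k \<in> {1..n}"
      then have "depth r n \<omega> \<le> depth r k \<omega>"
        using n_in depth_antimono_level[OF \<omega>(1), of k n r] r by auto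
      then show "k \<in> {k\<in>{1..d}. j < depth r k \<omega>}" using k n_in by auto
    qed
    have shorter: "take k w = take k (\<omega> j)" if "take n w = take n (\<omega> j)" "k \<le> n" for k w
      using arg_cong[OF that(1), of "take k"] that(2) by (simp add: min_def)
    have "B j = {w. take n w = take n (\<omega> j)}"
      unfolding B_def levels
    proof (intro Collect_cong iffI ballI)
      fix w assume agree: "\<forall>k\<in>{1..n}. take k w = take k (\<omega> j)"
      show "take n w = take n (\<omega> j)"
      proof (cases "n = 0")
        case False
        then have "n \<in> {1..n}" by simp
        with agree show ?thesis by (rule bspec)
      qed simp
    next
      fix w k assume agree: "take n w = take n (\<omega> j)" and "k \<in> {1..n}"
      then have "k \<le> n" by simp
      with agree show "take k w = take k (\<omega> j)" by (rule shorter)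
    qed
    then show ?thesis
      unfolding levels prod_prefix_prob_ratio[OF \<omega>(2)]
      by (simp add: prefix_prob_def measure_pmf.emeasure_eq_measure)
  qed
  have nn: "0 \<le> prefix_prob P k (\<omega> j) / prefix_prob P (k - 1) (\<omega> j)" for k j
    by (simp add: prefix_prob_def)
  have "emeasure M (cube r \<omega>) = (\<Prod>j\<in>J. emeasure (measure_pmf P) (B j))"
    unfolding cube_eq M_def by (rule emeasure_PiM_Collect) (simp_all add: J_def)
  also have "\<dots> = ennreal (\<Prod>j\<in>J. \<Prod>k\<in>{k\<in>{1..d}. j < depth r k \<omega>}.
      prefix_prob P k (\<omega> j) / prefix_prob P (k - 1) (\<omega> j))"
    unfolding B by (intro prod_ennreal prod_nonneg nn)
  also have "(\<Prod>j\<in>J. \<Prod>k\<in>{k\<in>{1..d}. j < depth r k \<omega>}.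
      prefix_prob P k (\<omega> j) / prefix_prob P (k - 1) (\<omega> j)) =
    (\<Prod>k\<in>{1..d}. \<Prod>j\<in>{j\<in>J. j < depth r k \<omega>}. prefix_prob P k (\<omega> j) / prefix_prob P (k - 1) (\<omega> j))"
    by (rule prod.swap_restrict) (simp_all add: J_def)
  also have "\<dots> = (\<Prod>k=1..d. \<Prod>j<depth r k \<omega>. prefix_prob P k (\<omega> j) / prefix_prob P (k - 1) (\<omega> j))"
  proof (rule prod.cong[OF refl])
    fix k assume "k \<in> {1..d}"
    then have "{j\<in>J. j < depth r k \<omega>} = {..<depth r k \<omega>}"
      using depth_le_1[of k] by (auto simp: J_def)
    then show "(\<Prod>j\<in>{j\<in>J. j < depth r k \<omega>}. prefix_prob P k (\<omega> j) / prefix_prob P (k - 1) (\<omega> j)) =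
       (\<Prod>j<depth r k \<omega>. prefix_prob P k (\<omega> j) / prefix_prob P (k - 1) (\<omega> j))"
      by (simp only:)
  qed
  finally show "emeasure M (cube r \<omega>) =
      ennreal (\<Prod>k=1..d. \<Prod>j<depth r k \<omega>. prefix_prob P k (\<omega> j) / prefix_prob P (k - 1) (\<omega> j))" .
qed

text \<open>
  Up to its depth, level \<open>k\<close> contributes \<open>lam k * ln contraction\<close>, which is \<open>lam k * ln r\<close> up to a
  constant, minus a sum of \<open>info_gap\<close>, which the law of large numbers bounds by a small multiple of
  the depth.  Since the depth is at most about \<open>- ln r / c\<close>, the tolerance \<open>c * (D - s) / d\<close> per
  level adds up over the \<open>d\<close> levels to the loss of exponent from \<open>D\<close> to \<open>s\<close>.
\<close>

lemma prod_ratio_le_powr: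
  fixes P :: "nat list pmf" and lam :: "nat \<Rightarrow> real" and K s :: real
  defines "D \<equiv> \<Sum>k=1..d. lam k"
  defines "b \<equiv> - ln a_min" and "c \<equiv> - ln a_max"
  assumes \<omega>: "\<omega> \<in> seqs" "\<And>j. \<omega> j \<in> set_pmf P" and r: "0 < r" "r \<le> 1" and s: "s < D"
    and lln: "\<And>k n. k \<in> {1..d} \<Longrightarrow>
      (\<Sum>j<n. info_gap P lam k (\<omega> j)) \<ge> - (c * (D - s) / d) * real n - K"
  shows "(\<Prod>k=1..d. \<Prod>j<depth r k \<omega>. prefix_prob P k (\<omega> j) / prefix_prob P (k - 1) (\<omega> j))
    \<le> exp (b * (\<Sum>k=1..d. \<bar>lam k\<bar>) + (D - s) * b + d * K) * r powr s"
proof -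
  let ?q = "\<lambda>k j. prefix_prob P k (\<omega> j)"
  have d: "real d > 0" using d_ge_2 by simp
  have c: "c > 0" unfolding c_def using a_min_pos a_min_le_max a_max_less_1 by simp
  have q_pos: "?q k j > 0" for k j by (rule prefix_prob_pos[OF \<omega>(2)])
  have q_neq: "?q k j \<noteq> 0" for k j using q_pos[of k j] by simp
  have level: "(\<Sum>j<depth r k \<omega>. ln (?q k j / ?q (k - 1) j))
      \<le> lam k * ln r + \<bar>lam k\<bar> * b + (D - s) / d * (- ln r + b) + K" if k: "k \<in> {1..d}" for k
  proof -
    define n where "n = depth r k \<omega>"
    have a_pos: "0 < a (take k (\<omega> j))" for j
      using a_take_pos[OF seqsD[OF \<omega>(1)] k] .
    have "(\<Sum>j<n. ln (?q k j / ?q (k - 1) j))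
        = (\<Sum>j<n. lam k * ln (a (take k (\<omega> j))) - info_gap P lam k (\<omega> j))"
      by (simp add: info_gap_def ln_divide_pos[OF q_pos q_pos])
    also have "\<dots> = lam k * ln (contraction k \<omega> n) - (\<Sum>j<n. info_gap P lam k (\<omega> j))"
      unfolding contraction_def
      by (subst ln_prod) (simp_all add: sum_subtractf sum_distrib_left less_imp_neq[OF a_pos, symmetric])
    also have "\<dots> \<le> lam k * ln (contraction k \<omega> n) + (c * (D - s) / d) * real n + K"
      using lln[OF k, of n] by simp
    also have "(c * (D - s) / d) * real n = (D - s) / d * (real n * c)" by simp
    also have "\<dots> \<le> (D - s) / d * (- ln r + b)"
      using depth_bound[OF \<omega>(1) k r] s d by (intro mult_left_mono) (simp_all add: n_def b_def c_def)
    also have "lam k * ln (contraction k \<omega> n) \<le> lam k * ln r + \<bar>lam k\<bar> * b"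
    proof -
      have c_pos: "0 < contraction k \<omega> n" using contraction_pos[OF \<omega>(1) k] .
      have "ln (contraction k \<omega> n) \<le> ln r"
        by (rule ln_mono) (use contraction_depth_le[OF \<omega>(1) k r(1)] c_pos r n_def in auto)
      moreover have "ln (a_min * r) \<le> ln (contraction k \<omega> n)"
        by (rule ln_mono) (use contraction_depth_gt[OF \<omega>(1) k r] c_pos a_min_pos r n_def in auto)
      moreover have "ln (a_min * r) = ln a_min + ln r"
        using a_min_pos r(1) by (rule ln_mult_pos)
      ultimately have "\<bar>ln (contraction k \<omega> n) - ln r\<bar> \<le> b" by (simp add: b_def)
      then have "\<bar>lam k\<bar> * \<bar>ln (contraction k \<omega> n) - ln r\<bar> \<le> \<bar>lam k\<bar> * b"
        by (rule mult_left_mono) simp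
      then have "lam k * (ln (contraction k \<omega> n) - ln r) \<le> \<bar>lam k\<bar> * b"
        unfolding abs_mult[symmetric] by linarith
      then show ?thesis by (simp add: algebra_simps)
    qed
    finally show ?thesis unfolding n_def by simp
  qed
  have "ln (\<Prod>k=1..d. \<Prod>j<depth r k \<omega>. ?q k j / ?q (k - 1) j)
      = (\<Sum>k=1..d. \<Sum>j<depth r k \<omega>. ln (?q k j / ?q (k - 1) j))"
    by (subst ln_prod) (auto simp: q_neq intro!: sum.cong ln_prod)
  also have "\<dots> \<le> (\<Sum>k=1..d. lam k * ln r + \<bar>lam k\<bar> * b + (D - s) / d * (- ln r + b) + K)"
    by (rule sum_mono) (rule level)
  also have "\<dots> = D * ln r + b * (\<Sum>k=1..d. \<bar>lam k\<bar>) + d * ((D - s) / d * (- ln r + b)) + d * K"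
    by (simp add: sum.distrib D_def sum_distrib_right sum_distrib_left mult.commute)
  also have "d * ((D - s) / d * (- ln r + b)) = (D - s) * (- ln r + b)"
    using d by simp
  also have "D * ln r + b * (\<Sum>k=1..d. \<bar>lam k\<bar>) + (D - s) * (- ln r + b) + d * K
     = (b * (\<Sum>k=1..d. \<bar>lam k\<bar>) + (D - s) * b + d * K) + s * ln r"
    by (simp add: algebra_simps)
  finally have "exp (ln (\<Prod>k=1..d. \<Prod>j<depth r k \<omega>. ?q k j / ?q (k - 1) j))
     \<le> exp ((b * (\<Sum>k=1..d. \<bar>lam k\<bar>) + (D - s) * b + d * K) + s * ln r)"
    by (simp only: exp_le_cancel_iff)
  moreover have "exp (ln (\<Prod>k=1..d. \<Prod>j<depth r k \<omega>. ?q k j / ?q (k - 1) j)) =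
      (\<Prod>k=1..d. \<Prod>j<depth r k \<omega>. ?q k j / ?q (k - 1) j)"
    using q_pos by (intro exp_ln prod_pos divide_pos_pos)
  ultimately show ?thesis
    using r by (simp only: exp_add powr_def) simp
qed

text \<open>
  The set \<open>E K\<close> of sequences obeying the law of large numbers with constant \<open>K\<close> has positive measure
  for some \<open>K\<close>.  On it, cubes of size \<open>r\<close> have measure at most \<open>C * r powr s\<close> for any \<open>s\<close> below the
  sum, and the points over a set of diameter at most \<open>r\<close> are covered by boundedly many such cubes;
  so the mass distribution principle applies.
\<close>

lemma bernoulli_lower_bound:
  fixes pos :: "'n::finite \<Rightarrow> nat" and \<Lambda> :: "(real ^ 'n) set" and P :: "nat list pmf"
  assumes pos: "bij_betw pos UNIV {1..d}" and sponge: "is_sponge d m a u pos \<Lambda>"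
    and P: "set_pmf P \<subseteq> words m d"
    and mean: "\<And>k. k \<in> {1..d} \<Longrightarrow> measure_pmf.expectation P (info_gap P lam k) = 0"
  shows "ereal (\<Sum>k=1..d. lam k) \<le> hausdorff_dim \<Lambda>"
  unfolding hausdorff_dim_def
proof (rule Inf_greatest, clarify, rule ccontr)
  fix s :: real
  define D where "D = (\<Sum>k=1..d. lam k)"
  assume s: "0 \<le> s" and zero: "hausdorff_measure s \<Lambda> = 0" and "\<not> ereal (\<Sum>k=1..d. lam k) \<le> ereal s"
  then have sD: "s < D" by (simp add: D_def)
  have "\<Lambda> \<noteq> {}" using sponge by (simp add: is_sponge_def)
  then have s_pos: "0 < s"
    using s zero hausdorff_measure_0_nonempty[of \<Lambda>] by (cases "s = 0") auto
  define \<epsilon> where "\<epsilon> = - ln a_max * (D - s) / d"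
  have \<epsilon>: "\<epsilon> > 0"
    unfolding \<epsilon>_def using sD d_ge_2 a_min_pos a_min_le_max a_max_less_1
    by (intro divide_pos_pos mult_pos_pos) auto
  define M where "M = Pi\<^sub>M UNIV (\<lambda>_::nat. measure_pmf P)"
  interpret M: prob_space M
    unfolding M_def by (rule prob_space_PiM) (rule prob_space_measure_pmf)
  define good where "good K \<omega> \<longleftrightarrow> (\<forall>j. \<omega> j \<in> set_pmf P) \<and>
      (\<forall>k\<in>{1..d}. \<forall>n. (\<Sum>j<n. info_gap P lam k (\<omega> j)) \<ge> - \<epsilon> * real n - real K)"
    for K :: nat and \<omega> :: "nat \<Rightarrow> nat list"
  define E where "E K = {\<omega>\<in>space M. good K \<omega>}" for K
  have E_meas: "E K \<in> sets M" for K
  proof -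
    have [measurable]: "(\<lambda>\<omega>. g (\<omega> j)) \<in> borel_measurable M" for g :: "nat list \<Rightarrow> real" and j
      unfolding M_def by (rule measurable_compose[OF measurable_component_singleton]) auto
    have [measurable]: "Measurable.pred M (\<lambda>\<omega>. \<omega> j \<in> set_pmf P)" for j
      unfolding M_def by (rule measurable_compose[OF measurable_component_singleton]) auto
    show ?thesis unfolding E_def good_def by measurable
  qed
  have AE_supp: "AE \<omega> in M. \<forall>j. \<omega> j \<in> set_pmf P"
  proof -
    interpret product_prob_space "\<lambda>_::nat. measure_pmf P" UNIV by unfold_locales
    show ?thesis
      unfolding AE_all_countable M_def
      by (intro allI AE_component) (simp_all add: AE_measure_pmf_iff)
  qed
  have AE_lln: "AE \<omega> in M. \<forall>k\<in>{1..d}. \<exists>K::nat. \<forall>n. (\<Sum>j<n. info_gap P lam k (\<omega> j)) \<ge> - \<epsilon> * real n - real K"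
    unfolding M_def
    by (intro AE_finite_allI iid_sum_ge_linear_AE \<epsilon> mean finite_subset[OF P finite_words]) simp_all
  have AE_good: "AE \<omega> in M. \<exists>K. good K \<omega>"
    using AE_supp AE_lln
  proof eventually_elim
    case (elim \<omega>)
    from bchoice[OF elim(2)] obtain K :: "nat \<Rightarrow> nat" where
      K: "\<forall>k\<in>{1..d}. \<forall>n. (\<Sum>j<n. info_gap P lam k (\<omega> j)) \<ge> - \<epsilon> * real n - real (K k)" ..
    have "good (\<Sum>k=1..d. K k) \<omega>"
      unfolding good_def
    proof (intro conjI ballI allI)
      fix k n assume k: "k \<in> {1..d}"
      have "K k \<le> (\<Sum>k=1..d. K k)" using k by (intro member_le_sum) auto
      then have "real (K k) \<le> real (\<Sum>k=1..d. K k)" by (rule of_nat_mono)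
      moreover have "(\<Sum>j<n. info_gap P lam k (\<omega> j)) \<ge> - \<epsilon> * real n - real (K k)" using K k by blast
      ultimately show "(\<Sum>j<n. info_gap P lam k (\<omega> j)) \<ge> - \<epsilon> * real n - real (\<Sum>k=1..d. K k)"
        by linarith
    qed (use elim in blast)
    then show ?case ..
  qed
  obtain K where K: "emeasure M (E K) > 0"
  proof -
    have "\<exists>K. emeasure M (E K) \<noteq> 0"
    proof (rule ccontr)
      assume "\<nexists>K. emeasure M (E K) \<noteq> 0"
      then have "E K \<in> null_sets M" for K using E_meas by blast
      then have "AE \<omega> in M. \<forall>K. \<omega> \<notin> E K"
        unfolding AE_all_countable by (intro allI AE_not_in)
      with AE_good have "AE \<omega> in M. False"
        using AE_space by eventually_elim (auto simp: E_def)
      then show False by simp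
    qed
    then show ?thesis using that by (auto simp: zero_less_iff_neq_zero)
  qed
  define x where "x \<omega> = (\<chi> c. coding (d + 1 - pos c) \<omega>)" for \<omega> :: "nat \<Rightarrow> nat list"
  have E_seqs: "E K \<subseteq> seqs" using P by (auto simp: E_def good_def seqs_def)
  define C where "C = exp (- ln a_min * (\<Sum>k=1..d. \<bar>lam k\<bar>) + (D - s) * - ln a_min + real d * real K)"
  have cube_small: "emeasure M (cube r \<omega>) \<le> ennreal (C * r powr s)" and cube_sets: "cube r \<omega> \<in> sets M"
    if "\<omega> \<in> E K" "0 < r" "r \<le> 1" for \<omega> r
  proof -
    have \<omega>: "\<omega> \<in> seqs" "\<And>j. \<omega> j \<in> set_pmf P" "good K \<omega>" using that E_seqs by (auto simp: E_def good_def)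
    show "cube r \<omega> \<in> sets M"
      unfolding M_def by (rule cube_measurable[OF \<omega>(1,2) that(2)])
    have lln: "- (- ln a_max * ((\<Sum>k=1..d. lam k) - s) / d) * real n - real K
        \<le> (\<Sum>j<n. info_gap P lam k (\<omega> j))" if "k \<in> {1..d}" for k n
      using \<omega>(3) that unfolding good_def \<epsilon>_def D_def by blast
    show "emeasure M (cube r \<omega>) \<le> ennreal (C * r powr s)"
      unfolding M_def emeasure_cube[OF \<omega>(1,2) that(2)] C_def D_def
      by (rule ennreal_leI, rule prod_ratio_le_powr[OF \<omega>(1,2) that(2,3) sD[unfolded D_def] lln])
  qed
  have "hausdorff_measure s \<Lambda> \<noteq> 0"
  proof (rule mass_distribution_principle[OF s_pos K, where x = x and C = "max_cubes * C"])
    show "x \<omega> \<in> \<Lambda>" if "\<omega> \<in> E K" for \<omega>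
      unfolding x_def using coding_in_sponge[OF pos sponge] E_seqs that by blast
    show "0 \<le> max_cubes * C" by (simp add: C_def)
    fix U :: "(real ^ 'n) set" and r :: real
    assume U: "bounded U" "diameter U \<le> r" and r: "0 < r" "r \<le> 1"
    define F where "F = {\<omega>\<in>E K. x \<omega> \<in> U}"
    have F: "F \<subseteq> seqs" "F \<subseteq> E K" using E_seqs by (auto simp: F_def)
    have "\<bar>coding k \<omega> - coding k \<omega>'\<bar> \<le> r" if "\<omega> \<in> F" "\<omega>' \<in> F" "k \<in> {1..d}" for \<omega> \<omega>' k
    proof -
      have "d + 1 - k \<in> {1..d}" using that(3) by auto
      then obtain c where c: "pos c = d + 1 - k"
        using bij_betw_imp_surj_on[OF pos] by (metis imageE)
      then have "d + 1 - pos c = k" using that(3) by auto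
      then have "\<bar>coding k \<omega> - coding k \<omega>'\<bar> = dist (x \<omega> $ c) (x \<omega>' $ c)"
        by (simp add: x_def dist_real_def)
      also have "\<dots> \<le> dist (x \<omega>) (x \<omega>')" by (rule dist_vec_nth_le)
      also have "\<dots> \<le> diameter U"
        using that U(1) by (intro diameter_bounded_bound) (auto simp: F_def)
      finally show ?thesis using U(2) by simp
    qed
    then have fin: "finite (cube r ` F)" and card: "card (cube r ` F) \<le> max_cubes"
      using card_cubes_le[OF F(1) r] by auto
    show "\<exists>T\<in>sets M. {\<omega>\<in>E K. x \<omega> \<in> U} \<subseteq> T \<and> emeasure M T \<le> ennreal (max_cubes * C * r powr s)"
    proof (intro bexI conjI)
      show "{\<omega>\<in>E K. x \<omega> \<in> U} \<subseteq> \<Union>(cube r ` F)"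
        by (auto simp: F_def cube_def)
      have sets: "cube r ` F \<subseteq> sets M" using cube_sets F(2) r by blast
      show "\<Union>(cube r ` F) \<in> sets M" using sets fin by (intro sets.finite_Union) auto
      have "emeasure M (\<Union>Q\<in>cube r ` F. Q) \<le> (\<Sum>Q\<in>cube r ` F. emeasure M Q)"
        using sets fin by (intro emeasure_subadditive_finite) auto
      also have "\<dots> \<le> (\<Sum>Q\<in>cube r ` F. ennreal (C * r powr s))"
        using cube_small F(2) r by (intro sum_mono) blast
      also have "\<dots> = ennreal (real (card (cube r ` F)) * (C * r powr s))"
        by (simp add: ennreal_mult C_def ennreal_of_nat_eq_real_of_nat)
      also have "\<dots> \<le> ennreal (max_cubes * C * r powr s)"
        using card by (intro ennreal_leI) (simp add: C_def mult.assoc mult_right_mono)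
      finally show "emeasure M (\<Union>(cube r ` F)) \<le> ennreal (max_cubes * C * r powr s)"
        by simp
    qed
  qed
  with zero show False by simp
qed

end

section \<open>The Bernoulli measure of a distribution\<close>

text \<open>
  The extension sums of \<open>p\<close> are the weights of its image under truncation of words; integrating a
  function of the prefix against \<open>p\<close> expresses this in the form in which it is used.
\<close>

lemma sum_words_take:
  "(\<Sum>w\<in>words m (k + n). p w * F (take k w)) = (\<Sum>v\<in>words m k. sum_extensions m p n v * F v)"
proof (induction n arbitrary: k F)
  case 0
  show ?case by (auto intro!: sum.cong simp: words_length)
next
  case (Suc n)
  have "(\<Sum>w\<in>words m (k + Suc n). p w * F (take k w))
      = (\<Sum>w\<in>words m (Suc k + n). p w * F (take k (take (Suc k) w)))"
    by (simp add: min_def)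
  also have "\<dots> = (\<Sum>v\<in>words m (Suc k). sum_extensions m p n v * F (take k v))"
    by (rule Suc.IH)
  also have "\<dots> = (\<Sum>v\<in>words m k. \<Sum>i=1..m v. sum_extensions m p n (v @ [i]) * F v)"
    unfolding sum_words_Suc by (intro sum.cong) (auto simp: words_length)
  also have "\<dots> = (\<Sum>v\<in>words m k. sum_extensions m p (Suc n) v * F v)"
    by (simp add: sum_distrib_right)
  finally show ?case .
qed

lemma pmf_of_weights:
  fixes W :: "'b \<Rightarrow> real"
  assumes "finite A" "\<And>x. x \<in> A \<Longrightarrow> 0 \<le> W x" "(\<Sum>x\<in>A. W x) = 1"
  obtains P where "set_pmf P \<subseteq> A" "\<And>x. x \<in> A \<Longrightarrow> pmf P x = W x"
proof -
  define f where "f x = (if x \<in> A then W x else 0)" for x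
  have nn: "0 \<le> f x" for x using assms(2) by (simp add: f_def)
  have "(\<integral>\<^sup>+x. ennreal (f x) \<partial>count_space UNIV) = (\<Sum>x\<in>A. ennreal (f x))"
    by (rule nn_integral_count_space') (use assms(1) in \<open>auto simp: f_def\<close>)
  also have "\<dots> = ennreal (\<Sum>x\<in>A. f x)" by (rule sum_ennreal) (rule nn)
  also have "(\<Sum>x\<in>A. f x) = 1" using assms(3) by (simp add: f_def)
  finally have prob: "(\<integral>\<^sup>+x. ennreal (f x) \<partial>count_space UNIV) = 1" by simp
  have "pmf (embed_pmf f) x = f x" for x
    by (rule pmf_embed_pmf[OF nn prob])
  then show ?thesis
    by (intro that[of "embed_pmf f"]) (auto simp: set_pmf_iff f_def split: if_splits)
qed

context sponge_data
begin

definition child_sum :: "real \<Rightarrow> nat list \<Rightarrow> real" where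
  "child_sum t v = (\<Sum>i=1..m v. a (v @ [i]) powr t)"

lemma last_level_children:
  assumes "v \<in> words m (d - 1)"
  shows "1 \<le> m v" "\<And>i. i \<in> {1..m v} \<Longrightarrow> 0 < a (v @ [i])" "\<And>i. i \<in> {1..m v} \<Longrightarrow> a (v @ [i]) < 1"
    "(\<Sum>i=1..m v. a (v @ [i])) \<le> 1"
proof -
  have d: "d - 1 < d" "Suc (d - 1) = d" using d_ge_2 by auto
  show "1 \<le> m v" using m_pos[OF d(1) assms] .
  have "v @ [i] \<in> words m d" if "i \<in> {1..m v}" for i
    using assms that words_Suc[of m "d - 1"] unfolding d(2) by auto
  then show "\<And>i. i \<in> {1..m v} \<Longrightarrow> 0 < a (v @ [i])" "\<And>i. i \<in> {1..m v} \<Longrightarrow> a (v @ [i]) < 1"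
    using a_range[of d] d_ge_2 by auto
  show "(\<Sum>i=1..m v. a (v @ [i])) \<le> 1" using a_sum_le_1[OF d(1) assms] .
qed

lemma child_sum_pos: "v \<in> words m (d - 1) \<Longrightarrow> 0 < child_sum t v"
  unfolding child_sum_def using last_level_children[of v]
  by (intro sum_pos) (auto simp: less_imp_neq[symmetric])

text \<open>
  The left-hand side, as a function of the exponent, is strictly decreasing because every ratio is
  less than \<open>1\<close>; it is nonnegative at \<open>0\<close>, where \<open>child_sum\<close> counts the children, and nonpositive at
  \<open>1\<close>, where the ratios of siblings sum to at most \<open>1\<close>.  So the definite description in
  \<open>sponge_t\<close> denotes.
\<close>

lemma sponge_t_root:
  assumes p: "p \<in> distributions d m"
  shows "(\<Sum>v\<in>words m (d - 1). p v * ln (child_sum (sponge_t d m a p) v)) = 0"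
proof -
  define g where "g t = (\<Sum>v\<in>words m (d - 1). p v * ln (child_sum t v))" for t
  have p_nonneg: "0 \<le> p v" if "v \<in> words m (d - 1)" for v
    using p that by (auto simp: distributions_def)
  have "\<exists>t\<ge>0. t \<le> 1 \<and> g t = 0"
  proof (rule IVT2')
    show "g 1 \<le> 0"
      unfolding g_def
    proof (intro sum_nonpos mult_nonneg_nonpos p_nonneg)
      fix v assume v: "v \<in> words m (d - 1)"
      have "child_sum 1 v = (\<Sum>i=1..m v. a (v @ [i]))"
        unfolding child_sum_def
        by (intro sum.cong refl powr_one less_imp_le[OF last_level_children(2)[OF v]])
      then show "ln (child_sum 1 v) \<le> 0"
        using child_sum_pos[OF v, of 1] last_level_children(4)[OF v] by simp
    qed
    show "0 \<le> g 0"
      unfolding g_def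
    proof (intro sum_nonneg mult_nonneg_nonneg p_nonneg)
      fix v assume v: "v \<in> words m (d - 1)"
      have "child_sum 0 v = (\<Sum>i=1..m v. 1)"
        unfolding child_sum_def
        by (intro sum.cong refl) (use last_level_children(2)[OF v] in \<open>auto simp: less_imp_neq[symmetric]\<close>)
      then show "0 \<le> ln (child_sum 0 v)"
        using last_level_children(1)[OF v] by simp
    qed
    show "continuous_on {0..1} g"
      unfolding g_def
    proof (intro continuous_intros)
      fix v assume v: "v \<in> words m (d - 1)"
      show "continuous_on {0..1} (\<lambda>t. child_sum t v)"
        unfolding child_sum_def
        by (intro continuous_intros) (use last_level_children(2)[OF v] in \<open>auto simp: less_imp_neq[symmetric]\<close>)
      show "\<forall>t\<in>{0..1}. child_sum t v \<noteq> 0"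
        using child_sum_pos[OF v] by (auto simp: less_imp_neq[symmetric])
    qed
  qed simp
  then obtain t where t: "0 \<le> t" "t \<le> 1" "g t = 0" by auto
  have strict: "g t2 < g t1" if "t1 < t2" for t1 t2
  proof -
    have less: "ln (child_sum t2 v) < ln (child_sum t1 v)" if v: "v \<in> words m (d - 1)" for v
    proof -
      have "child_sum t2 v < child_sum t1 v"
        unfolding child_sum_def
        using last_level_children(1-3)[OF v] \<open>t1 < t2\<close>
        by (intro sum_strict_mono powr_less_mono') auto
      then show ?thesis using child_sum_pos[OF v] by (intro ln_less_cancel_iff[THEN iffD2])
    qed
    have "\<exists>v\<in>words m (d - 1). 0 < p v"
    proof (rule ccontr)
      assume "\<not> (\<exists>v\<in>words m (d - 1). 0 < p v)"
      then have "(\<Sum>v\<in>words m (d - 1). p v) \<le> 0" by (intro sum_nonpos) (auto simp: not_less)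
      then show False using p by (simp add: distributions_def)
    qed
    then obtain v where v: "v \<in> words m (d - 1)" "0 < p v" ..
    have "p v * ln (child_sum t2 v) < p v * ln (child_sum t1 v)"
      using less[OF v(1)] v(2) by (rule mult_strict_left_mono)
    then show ?thesis
      unfolding g_def using v(1)
      by (intro sum_strict_mono_ex1 finite_words ballI mult_left_mono p_nonneg less_imp_le[OF less]) auto
  qed
  have "sponge_t d m a p = t"
    unfolding sponge_t_def child_sum_def[symmetric] g_def[symmetric]
  proof (rule the_equality)
    fix t' assume "0 \<le> t' \<and> t' \<le> 1 \<and> g t' = 0"
    then show "t' = t" using strict[of t t'] strict[of t' t] t(3) by (cases t t' rule: linorder_cases) auto
  qed (use t in simp)
  then show ?thesis using t(3) by (simp add: g_def)
qed

text \<open>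
  The Bernoulli measure that realises the bound extends \<open>p\<close> to full words by choosing the last index
  with probability proportional to \<open>a powr t\<close>.  Its prefix probabilities are the marginals of \<open>p\<close>, so
  for \<open>k < d\<close> the definition of \<open>sponge_lambda\<close> says that \<open>info_gap\<close> has mean \<open>0\<close>.  At the last level
  \<open>info_gap\<close> with exponent \<open>t\<close> equals \<open>ln (child_sum t v)\<close>, and its mean vanishes by the equation
  that defines \<open>t\<close>.
\<close>

lemma distribution_lower_bound:
  fixes pos :: "'n::finite \<Rightarrow> nat" and \<Lambda> :: "(real ^ 'n) set"
  assumes pos: "bij_betw pos UNIV {1..d}" and sponge: "is_sponge d m a u pos \<Lambda>"
    and p: "p \<in> distributions d m"
  shows "ereal ((\<Sum>k=1..d-1. sponge_lambda d m a p k) + sponge_t d m a p) \<le> hausdorff_dim \<Lambda>"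
proof -
  define t where "t = sponge_t d m a p"
  define W where "W w = p (take (d - 1) w) * (a w powr t / child_sum t (take (d - 1) w))" for w
  define lam where "lam k = (if k = d then t else sponge_lambda d m a p k)" for k
  let ?marg = "marginal d m p"
  have d: "Suc (d - 1) = d" using d_ge_2 by simp
  have p_nonneg: "0 \<le> p v" if "v \<in> words m (d - 1)" for v
    using p that by (auto simp: distributions_def)
  have W_nonneg: "0 \<le> W w" if "w \<in> words m d" for w
  proof -
    have "take (d - 1) w \<in> words m (d - 1)" using that by (rule words_take) simp
    then show ?thesis unfolding W_def by (intro mult_nonneg_nonneg divide_nonneg_nonneg p_nonneg less_imp_le[OF child_sum_pos]) auto
  qed
  have marginal_sum: "(\<Sum>w\<in>words m d. W w * F (take k w)) = (\<Sum>v\<in>words m k. ?marg v * F v)"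
    if k: "k \<le> d - 1" for k and F :: "nat list \<Rightarrow> real"
  proof -
    have "(\<Sum>w\<in>words m d. W w * F (take k w))
        = (\<Sum>v\<in>words m (d - 1). \<Sum>i=1..m v. W (v @ [i]) * F (take k (v @ [i])))"
      using sum_words_Suc[of "\<lambda>w. W w * F (take k w)" m "d - 1"] unfolding d .
    also have "\<dots> = (\<Sum>v\<in>words m (d - 1). p v * F (take k v))"
    proof (rule sum.cong[OF refl])
      fix v assume v: "v \<in> words m (d - 1)"
      have "(\<Sum>i=1..m v. W (v @ [i]) * F (take k (v @ [i])))
          = (\<Sum>i=1..m v. (p v * F (take k v) / child_sum t v) * a (v @ [i]) powr t)"
        using k words_length[OF v] by (intro sum.cong) (auto simp: W_def)
      also have "\<dots> = (p v * F (take k v) / child_sum t v) * child_sum t v"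
        by (simp add: child_sum_def sum_distrib_left)
      also have "\<dots> = p v * F (take k v)" using child_sum_pos[OF v, of t] by simp
      finally show "(\<Sum>i=1..m v. W (v @ [i]) * F (take k (v @ [i]))) = p v * F (take k v)" .
    qed
    also have "\<dots> = (\<Sum>v\<in>words m k. sum_extensions m p (d - 1 - k) v * F v)"
      using sum_words_take[of p F k m "d - 1 - k"] unfolding le_add_diff_inverse[OF k] .
    also have "\<dots> = (\<Sum>v\<in>words m k. ?marg v * F v)"
      by (intro sum.cong) (auto simp: marginal_def words_length)
    finally show ?thesis .
  qed
  have p_total: "(\<Sum>v\<in>words m (d - 1). p v) = 1" using p by (simp add: distributions_def)
  have marg_top: "?marg v = p v" if "v \<in> words m (d - 1)" for v
    using words_length[OF that] by (simp add: marginal_def)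
  have W_total: "(\<Sum>w\<in>words m d. W w) = 1"
    using marginal_sum[of "d - 1" "\<lambda>_. 1"] marg_top p_total by simp
  obtain P where P: "set_pmf P \<subseteq> words m d" "\<And>w. w \<in> words m d \<Longrightarrow> pmf P w = W w"
    using pmf_of_weights[OF finite_words W_nonneg W_total] by blast
  have expect: "measure_pmf.expectation P f = (\<Sum>w\<in>words m d. W w * f w)" for f
    by (subst integral_measure_pmf_real[of "words m d"])
       (use P finite_words in \<open>auto simp: mult.commute intro!: sum.cong\<close>)
  have prefix: "prefix_prob P k w = (\<Sum>w'\<in>words m d. W w' * indicator {take k w} (take k w'))" for k w
  proof -
    have "prefix_prob P k w = measure_pmf.expectation P (indicator {w'. take k w' = take k w})"
      by (simp add: prefix_prob_def)
    also have "\<dots> = (\<Sum>w'\<in>words m d. W w' * indicator {take k w} (take k w'))"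
      unfolding expect by (intro sum.cong) (auto simp: indicator_def)
    finally show ?thesis .
  qed
  have prefix_marg: "prefix_prob P k w = ?marg (take k w)" if w: "w \<in> words m d" and k: "k \<le> d - 1" for k w
  proof -
    have "take k w \<in> words m k" using w by (rule words_take) (use k in simp)
    then show ?thesis
      unfolding prefix marginal_sum[OF k] using finite_words[of m k]
      by (simp add: indicator_def if_distrib cong: if_cong)
  qed
  have prefix_full: "prefix_prob P d w = W w" if w: "w \<in> words m d" for w
  proof -
    have "prefix_prob P d w = (\<Sum>w'\<in>words m d. W w' * indicator {w} w')"
      unfolding prefix using w by (intro sum.cong) (auto simp: words_length)
    then show ?thesis using w finite_words[of m d] by (simp add: indicator_def if_distrib cong: if_cong)
  qed
  have "ereal (\<Sum>k=1..d. lam k) \<le> hausdorff_dim \<Lambda>"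
  proof (rule bernoulli_lower_bound[OF pos sponge P(1)])
    fix k assume k: "k \<in> {1..d}"
    show "measure_pmf.expectation P (info_gap P lam k) = 0"
    proof (cases "k = d")
      case True
      have "W w * info_gap P lam k w = W w * ln (child_sum t (take (d - 1) w))" if w: "w \<in> words m d" for w
      \<comment> \<open>Letters of weight \<open>0\<close> do not contribute, whatever value \<open>ln 0\<close> has.\<close>
      proof (cases "W w = 0")
        case False
        define v where "v = take (d - 1) w"
        have v: "v \<in> words m (d - 1)" using w unfolding v_def by (rule words_take) simp
        have a_pos: "0 < a w" using a_range[of d w] w d_ge_2 by simp
        have W_eq: "W w = p v * (a w powr t / child_sum t v)" by (simp only: W_def v_def)
        have p_pos: "0 < p v" using False p_nonneg[OF v] by (auto simp: W_eq less_le)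
        have powr_pos: "0 < a w powr t" using a_pos by simp
        have "ln (W w) = ln (p v) + ln (a w powr t / child_sum t v)"
          unfolding W_eq by (intro ln_mult_pos divide_pos_pos p_pos powr_pos child_sum_pos v)
        also have "ln (a w powr t / child_sum t v) = ln (a w powr t) - ln (child_sum t v)"
          by (intro ln_divide_pos powr_pos child_sum_pos v)
        finally have "ln (W w) = ln (p v) + (ln (a w powr t) - ln (child_sum t v))" .
        moreover have "prefix_prob P (d - 1) w = p v"
          using prefix_marg[OF w order.refl] marg_top[OF v] by (simp only: v_def)
        ultimately have "info_gap P lam k w = ln (child_sum t v)"
          using True w a_pos prefix_full[OF w] words_length[OF w]
          by (simp add: info_gap_def lam_def ln_powr)
        then show ?thesis by (simp add: v_def)
      qed simp
      then have "measure_pmf.expectation P (info_gap P lam k)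
          = (\<Sum>w\<in>words m d. W w * ln (child_sum t (take (d - 1) w)))"
        unfolding expect by (intro sum.cong) auto
      also have "\<dots> = (\<Sum>v\<in>words m (d - 1). p v * ln (child_sum t v))"
        using marginal_sum[of "d - 1" "\<lambda>v. ln (child_sum t v)"] marg_top by simp
      also have "\<dots> = 0" using sponge_t_root[OF p] by (simp add: t_def)
      finally show ?thesis .
    next
      case False
      then have k': "k \<le> d - 1" "k - 1 \<le> d - 1" and lam_k: "lam k = sponge_lambda d m a p k"
        using k by (auto simp: lam_def)
      define N1 where "N1 = (\<Sum>v\<in>words m k. ?marg v * ln (?marg v))"
      define N0 where "N0 = (\<Sum>v\<in>words m (k - 1). ?marg v * ln (?marg v))"
      define Den where "Den = (\<Sum>v\<in>words m k. ?marg v * ln (a v))"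
      have Den_eq: "(\<Sum>w\<in>words m d. W w * ln (a (take k w))) = Den"
        unfolding Den_def by (rule marginal_sum[OF k'(1)])
      have N1_eq: "(\<Sum>w\<in>words m d. W w * ln (?marg (take k w))) = N1"
        unfolding N1_def by (rule marginal_sum[OF k'(1)])
      have N0_eq: "(\<Sum>w\<in>words m d. W w * ln (?marg (take (k - 1) w))) = N0"
        unfolding N0_def by (rule marginal_sum[OF k'(2)])
      have "Den = (\<Sum>w\<in>words m d. W w * ln (a (take k w)))"
        by (rule Den_eq[symmetric])
      also have "\<dots> \<le> (\<Sum>w\<in>words m d. W w * ln a_max)"
        using k a_max_ge a_take_pos by (intro sum_mono mult_left_mono W_nonneg ln_mono) auto
      also have "\<dots> = ln a_max" using W_total by (simp add: sum_distrib_right[symmetric])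
      also have "\<dots> < 0" using a_max_less_1 a_min_pos a_min_le_max by simp
      finally have Den: "Den \<noteq> 0" by simp
      have "measure_pmf.expectation P (info_gap P lam k)
        = (\<Sum>w\<in>words m d. lam k * (W w * ln (a (take k w))) - W w * ln (?marg (take k w))
             + W w * ln (?marg (take (k - 1) w)))"
        unfolding expect using k'
        by (intro sum.cong refl) (simp add: info_gap_def prefix_marg algebra_simps)
      also have "\<dots> = lam k * Den - N1 + N0"
        unfolding sum.distrib sum_subtractf sum_distrib_left[symmetric] Den_eq N1_eq N0_eq ..
      also have "lam k * Den = N1 - N0"
        using Den unfolding lam_k sponge_lambda_def N1_def[symmetric] N0_def[symmetric] Den_def[symmetric] by simp
      finally show ?thesis by simp
    qed
  qed
  moreover have "(\<Sum>k=1..d. lam k) = (\<Sum>k=1..d-1. sponge_lambda d m a p k) + t"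
  proof -
    have "(\<Sum>k=1..d. lam k) = (\<Sum>k=1..d-1. lam k) + lam d"
      using sum.cl_ivl_Suc[of lam 1 "d - 1"] d_ge_2 unfolding d by simp
    also have "(\<Sum>k=1..d-1. lam k) = (\<Sum>k=1..d-1. sponge_lambda d m a p k)"
      using d_ge_2 by (intro sum.cong) (auto simp: lam_def)
    finally show ?thesis by (simp add: lam_def)
  qed
  ultimately show ?thesis by (simp add: t_def)
qed

end


section \<open>The lower bound for the dimension of a sponge\<close>

theorem theorem1:
  fixes d :: nat
    and m :: "nat list \<Rightarrow> nat"
    and a u :: "nat list \<Rightarrow> real"
    and pos :: "'n::finite \<Rightarrow> nat"
    and \<Lambda> :: "(real ^ 'n) set"
  assumes "sponge_data d m a u"
    and "bij_betw pos UNIV {1..d}"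
    and "is_sponge d m a u pos \<Lambda>"
  shows "hausdorff_dim \<Lambda> \<ge>
    (SUP p\<in>distributions d m.
       ereal ((\<Sum>k=1..d-1. sponge_lambda d m a p k) + sponge_t d m a p))"
  using sponge_data.distribution_lower_bound[OF assms] by (intro SUP_least)

end
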